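(* Let $a$ be a selfadjoint random variable in a non-commutative probability space, with free cumulants $\kappa_r(a,\dots,a)$, $r\ge 1$. Let $N\ge 1$ and let $A=(a_{ij})_{i,j=1}^N$ be a matrix whose entries $a_{ij}$ are elements of a non-commutative probability space such that the joint free cumulants of the entries are given as follows: for all $r\ge 1$ and all $i(1),\dots,i(r)\in\{1,\dots,N\}$, $$\kappa_r(a_{i(1)i(2)},a_{i(2)i(3)},\dots,a_{i(r)i(1)})=\frac{1}{N^{r-1}}\,\kappa_r(a,\dots,a),$$ and all other free cumulants of the entries are zero, i.e. $\kappa_r(a_{i(1)j(1)},\dots,a_{i(r)j(r)})=0$ unless $j(1)=i(2),\ j(2)=i(3),\dots,\ j(r)=i(1)$. Then for all $n\ge 1$ and all $k(1),\dots,k(n)\ge 1$, $$\kappa_n\bigl(\mathrm{Tr}(A^{k(1)}),\dots,\mathrm{Tr}(A^{k(n)})\bigr)=N^{-n+2}\,\kappa_n\bigl(a^{k(1)},\dots,a^{k(n)}\bigr).$$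
   Context: A non-commutative probability space is a unital complex algebra with a unital linear functional $\varphi$ (the state). The free cumulants $\kappa_r$ of such a space are the multilinear functionals determined by the moment-cumulant formula $\varphi(b_1\cdots b_n)=\sum_{\pi\in NC(n)}\prod_{V\in\pi}\kappa_{|V|}(b_i: i\in V)$, where $NC(n)$ is the set of non-crossing partitions of $\{1,\dots,n\}$ and the arguments in each block are taken in increasing order. On the left-hand side of the conclusion, $\kappa_n$ is the free cumulant in the space containing the entries $a_{ij}$; on the right-hand side, $\kappa_n$ is the free cumulant in the space containing $a$. $A^k$ denotes the usual matrix power (with products of entries taken in the algebra) and $\mathrm{Tr}(B)=\sum_{i=1}^N b_{ii}$ is the unnormalized trace of $B=(b_{ij})$, an element of the algebra containing the entries. *)

theory Defs
  imports
    Complex_Main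
    "HOL-Library.Disjoint_Sets"
    "Jordan_Normal_Form.Matrix"
begin

locale nc_probability_space =
  vector_space scale + state: Vector_Spaces.linear scale "(*)" \<phi>
  for scale :: "complex \<Rightarrow> 'a::ring_1 \<Rightarrow> 'a" (infixr \<open>*\<^sub>C\<close> 75)
    and \<phi> :: "'a \<Rightarrow> complex" +
  assumes scale_mult_left: "(c *\<^sub>C x) * y = c *\<^sub>C (x * y)"
    and scale_mult_right: "x * (c *\<^sub>C y) = c *\<^sub>C (x * y)"
    and state_one: "\<phi> 1 = 1"

text \<open>Selfadjointness needs an involution on the algebra. As states are only required to be linear
  and unital, no positivity or compatibility with the involution is imposed on \<open>\<phi>\<close>.\<close>

locale nc_probability_space_with_star = nc_probability_space +
  fixes star :: "'a \<Rightarrow> 'a"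
  assumes star_star: "star (star x) = x"
    and star_add: "star (x + y) = star x + star y"
    and star_scale: "star (c *\<^sub>C x) = cnj c *\<^sub>C star x"
    and star_mult: "star (x * y) = star y * star x"
begin

definition selfadjoint :: "'a \<Rightarrow> bool"
  where "selfadjoint x \<longleftrightarrow> star x = x"

end

definition noncrossing :: "'i::linorder set set \<Rightarrow> bool"
  where "noncrossing P \<longleftrightarrow>
    (\<forall>V\<in>P. \<forall>W\<in>P. \<forall>i\<in>V. \<forall>j\<in>W. \<forall>k\<in>V. \<forall>l\<in>W. i < j \<and> j < k \<and> k < l \<longrightarrow> V = W)"

text \<open>Positions are counted from 0, as for lists, so the ground set is \<open>{0, \<dots>, n - 1}\<close>.\<close>

definition NC :: "nat \<Rightarrow> nat set set set"
  where "NC n = {P. partition_on {..<n} P \<and> noncrossing P}"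

lemma finite_NC: "finite (NC n)"
proof (rule finite_subset)
  show "NC n \<subseteq> {P. partition_on {..<n} P}" unfolding NC_def by blast
  show "finite {P. partition_on {..<n} P}" by (rule finitely_many_partition_on) simp
qed

lemma NC_partition: "P \<in> NC n \<Longrightarrow> partition_on {..<n} P"
  unfolding NC_def by blast

lemma one_block_in_NC: "n > 0 \<Longrightarrow> {{..<n}} \<in> NC n"
  unfolding NC_def noncrossing_def partition_on_def disjoint_def
  by (simp add: lessThan_empty_iff eq_commute[of "{}"])

lemma NC_proper_block:
  assumes "P \<in> NC n - {{{..<n}}}" "V \<in> P"
  shows "V \<subset> {..<n}"
proof -
  have P: "partition_on {..<n} P" using assms NC_partition by blast
  have "V \<noteq> {..<n}"
  proof
    assume V: "V = {..<n}"
    have "W = V" if W: "W \<in> P" for W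
    proof (rule ccontr)
      assume "W \<noteq> V"
      then have "W \<inter> V = {}" using disjointD[OF partition_onD2[OF P] W assms(2)] by blast
      moreover have "W \<subseteq> V" using W partition_onD1[OF P] V by blast
      moreover have "W \<noteq> {}" using W partition_onD3[OF P] by blast
      ultimately show False by blast
    qed
    then have "P = {V}" using assms(2) by blast
    then show False using V assms(1) by blast
  qed
  moreover have "V \<subseteq> {..<n}" using assms(2) partition_onD1[OF P] by blast
  ultimately show ?thesis by blast
qed

lemma length_nths_proper:
  assumes "V \<subset> {..<length bs}"
  shows "length (nths bs V) < length bs"
proof -
  have "{i. i < length bs \<and> i \<in> V} = V"
    using assms by auto
  then have "length (nths bs V) = card V"
    by (simp add: length_nths)
  also have "\<dots> < length bs"
    using psubset_card_mono[OF _ assms] by simp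
  finally show ?thesis .
qed

text \<open>The free cumulant \<open>\<kappa>\<^sub>n(b\<^sub>1, \<dots>, b\<^sub>n)\<close> is \<open>free_cumulant \<phi> [b\<^sub>1, \<dots>, b\<^sub>n]\<close>. The recursion is
  the moment-cumulant formula solved for the term of the one-block partition; \<open>nths bs V\<close> is the
  list of the \<open>b\<^sub>i\<close> with \<open>i \<in> V\<close>, in increasing order of \<open>i\<close>. That this is the family
  determined by the moment-cumulant formula is shown in \<open>moment_cumulant_formula\<close> and
  \<open>free_cumulant_unique\<close> below.\<close>

function free_cumulant :: "('a::monoid_mult \<Rightarrow> complex) \<Rightarrow> 'a list \<Rightarrow> complex"
  where "free_cumulant \<phi> bs = \<phi> (prod_list bs) -
    (\<Sum>P\<in>NC (length bs) - {{{..<length bs}}}. \<Prod>V\<in>P. free_cumulant \<phi> (nths bs V))"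
  by pat_completeness auto
termination
proof (relation "measure (\<lambda>(\<phi>, bs). length bs)")
  fix \<phi> :: "'a \<Rightarrow> complex" and bs :: "'a list" and P V
  assume "P \<in> NC (length bs) - {{{..<length bs}}}" "V \<in> P"
  then show "((\<phi>, nths bs V), (\<phi>, bs)) \<in> measure (\<lambda>(\<phi>, bs). length bs)"
    using length_nths_proper[OF NC_proper_block] by simp
qed simp

declare free_cumulant.simps [simp del]

theorem moment_cumulant_formula:
  assumes "bs \<noteq> []"
  shows "\<phi> (prod_list bs) = (\<Sum>P\<in>NC (length bs). \<Prod>V\<in>P. free_cumulant \<phi> (nths bs V))"
proof -
  let ?n = "length bs"
  have "(\<Sum>P\<in>NC ?n. \<Prod>V\<in>P. free_cumulant \<phi> (nths bs V)) =
      (\<Prod>V\<in>{{..<?n}}. free_cumulant \<phi> (nths bs V)) +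
      (\<Sum>P\<in>NC ?n - {{{..<?n}}}. \<Prod>V\<in>P. free_cumulant \<phi> (nths bs V))"
    using assms by (intro sum.remove finite_NC one_block_in_NC) simp
  also have "(\<Prod>V\<in>{{..<?n}}. free_cumulant \<phi> (nths bs V)) = free_cumulant \<phi> bs"
    by (simp add: nths_all)
  finally show ?thesis
    by (subst (asm) free_cumulant.simps[of \<phi> bs]) simp
qed

theorem free_cumulant_unique:
  assumes "\<And>bs. bs \<noteq> [] \<Longrightarrow>
      \<phi> (prod_list bs) = (\<Sum>P\<in>NC (length bs). \<Prod>V\<in>P. \<kappa> (nths bs V))"
    and "bs \<noteq> []"
  shows "\<kappa> bs = free_cumulant \<phi> bs"
  using assms(2)
proof (induction "length bs" arbitrary: bs rule: less_induct)
  case less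
  let ?n = "length bs"
  have "(\<Prod>V\<in>P. \<kappa> (nths bs V)) = (\<Prod>V\<in>P. free_cumulant \<phi> (nths bs V))"
    if P: "P \<in> NC ?n - {{{..<?n}}}" for P
  proof (rule prod.cong)
    fix V assume V: "V \<in> P"
    have sub: "V \<subset> {..<?n}" using NC_proper_block[OF P V] .
    have "V \<noteq> {}" using P V by (auto simp: NC_def partition_on_def)
    then obtain v where "v \<in> V" "v < ?n" using sub by auto
    then have "bs ! v \<in> set (nths bs V)" by (auto simp: set_nths)
    then have "nths bs V \<noteq> []" by auto
    then show "\<kappa> (nths bs V) = free_cumulant \<phi> (nths bs V)"
      using less.hyps length_nths_proper[OF sub] by blast
  qed simp
  then have rest: "(\<Sum>P\<in>NC ?n - {{{..<?n}}}. \<Prod>V\<in>P. \<kappa> (nths bs V)) =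
      (\<Sum>P\<in>NC ?n - {{{..<?n}}}. \<Prod>V\<in>P. free_cumulant \<phi> (nths bs V))"
    by (rule sum.cong[OF refl])
  have "\<phi> (prod_list bs) = (\<Sum>P\<in>NC ?n. \<Prod>V\<in>P. \<kappa> (nths bs V))"
    using assms(1) less.prems .
  also have "\<dots> = (\<Prod>V\<in>{{..<?n}}. \<kappa> (nths bs V)) +
      (\<Sum>P\<in>NC ?n - {{{..<?n}}}. \<Prod>V\<in>P. \<kappa> (nths bs V))"
    using less.prems by (intro sum.remove finite_NC one_block_in_NC) simp
  also have "(\<Prod>V\<in>{{..<?n}}. \<kappa> (nths bs V)) = \<kappa> bs"
    by (simp add: nths_all)
  finally show ?case
    unfolding rest by (subst free_cumulant.simps) simp
qed

lemma nths_list_update_notin: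
  "i \<notin> V \<Longrightarrow> nths (bs[i := x]) V = nths bs V"
  by (induction bs arbitrary: i V) (auto simp: nths_Cons split: nat.split)

lemma nths_list_update_in:
  "i \<in> V \<Longrightarrow> i < length bs \<Longrightarrow>
    \<exists>j < length (nths bs V). \<forall>x. nths (bs[i := x]) V = (nths bs V)[j := x]"
proof (induction bs arbitrary: i V)
  case (Cons b bs)
  show ?case
  proof (cases i)
    case 0
    then show ?thesis using Cons.prems by (auto simp: nths_Cons intro!: exI[of _ 0])
  next
    case (Suc i')
    then obtain j where j: "j < length (nths bs {k. Suc k \<in> V})"
        "\<And>x. nths (bs[i' := x]) {k. Suc k \<in> V} = (nths bs {k. Suc k \<in> V})[j := x]"
      using Cons.IH[of i' "{k. Suc k \<in> V}"] Cons.prems by auto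
    show ?thesis
      by (rule exI[of _ "if 0 \<in> V then Suc j else j"]) (use j Suc in \<open>auto simp: nths_Cons\<close>)
  qed
qed simp

context nc_probability_space
begin

theorem free_cumulant_multilinear:
  assumes "i < length bs"
  shows "Vector_Spaces.linear scale (*) (\<lambda>x. free_cumulant \<phi> (bs[i := x]))"
  using assms
proof (induction "length bs" arbitrary: bs i rule: less_induct)
  case less
  interpret vs: vector_space_pair scale "(*) :: complex \<Rightarrow> _" ..
  let ?n = "length bs"
  let ?lin = "Vector_Spaces.linear scale ((*) :: complex \<Rightarrow> _)"
  have "?lin (\<lambda>x. \<phi> (prod_list (take i bs) * x * prod_list (drop (Suc i) bs)))"
    unfolding Vector_Spaces.linear_iff
    by (simp add: vector_space_axioms state.vs2.vector_space_axioms distrib_left distrib_right scale_mult_left scale_mult_right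
        state.add state.scale)
  then have "?lin (\<lambda>x. \<phi> (prod_list (bs[i := x])))"
    using less.prems by (simp add: upd_conv_take_nth_drop mult.assoc)
  moreover have "?lin (\<lambda>x. \<Prod>V\<in>P. free_cumulant \<phi> (nths (bs[i := x]) V))"
    if P: "P \<in> NC ?n - {{{..<?n}}}" for P
  proof -
    have part: "partition_on {..<?n} P" using P by (simp add: NC_def)
    then have fin: "finite P" by (rule finite_elements[rotated]) simp
    obtain W where W: "W \<in> P" "i \<in> W"
      using part less.prems by (auto simp: partition_on_def)
    have other: "free_cumulant \<phi> (nths (bs[i := x]) V) = free_cumulant \<phi> (nths bs V)"
      if "V \<in> P - {W}" for V x
      using part that W by (subst nths_list_update_notin) (auto simp: partition_on_def disjoint_def)
    obtain j where j: "j < length (nths bs W)"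
        "\<And>x. nths (bs[i := x]) W = (nths bs W)[j := x]"
      using nths_list_update_in[OF W(2) less.prems] by blast
    have "?lin (\<lambda>x. free_cumulant \<phi> ((nths bs W)[j := x]))"
      using less.hyps length_nths_proper[OF NC_proper_block[OF P W(1)]] j(1) by blast
    then have "?lin (\<lambda>x. (\<Prod>V\<in>P - {W}. free_cumulant \<phi> (nths bs V)) *
        free_cumulant \<phi> ((nths bs W)[j := x]))"
      by (rule vs.linear_compose_scale_right)
    then show ?thesis
      by (simp add: prod.remove[OF fin W(1)] other j(2) mult.commute)
  qed
  then have "?lin (\<lambda>x. \<Sum>P\<in>NC ?n - {{{..<?n}}}. \<Prod>V\<in>P. free_cumulant \<phi> (nths (bs[i := x]) V))"
    by (intro vs.linear_compose_sum) blast
  ultimately have "?lin (\<lambda>x. \<phi> (prod_list (bs[i := x])) -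
      (\<Sum>P\<in>NC ?n - {{{..<?n}}}. \<Prod>V\<in>P. free_cumulant \<phi> (nths (bs[i := x]) V)))"
    by (rule vs.linear_compose_sub)
  then show ?case
    by (subst free_cumulant.simps) simp
qed

end

definition Tr :: "'a::comm_monoid_add mat \<Rightarrow> 'a"
  where "Tr B = (\<Sum>i<dim_row B. B $$ (i, i))"

end

(* Reading a word from left to right with a stack of letters whose block is not yet complete turns
   the moment-cumulant formula into a shift-reduce scan: a noncrossing block is complete when its
   last element is read, and it then consists of the topmost letters of the stack.

   Scan the word of entries of Tr(A^k(1)) ... Tr(A^k(n)) and sum over all indices. A popped block is
   a cyclic word, and summing over its interior indices cancels the factor 1/N^(r-1), except for
   one factor 1/N for each earlier trace that the current trace is merged with; a trace that has lost
   all its letters leaves Tr(1) = N. Hence the sum only depends on how many letters of each trace are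
   left on the stack, and it is given by a scan over such shapes in which a merger costs beta = 1/N
   and an emptied trace contributes alpha = N. A connected component of m traces needs m - 1 mergers
   and is emptied once, so the scan over shapes is in turn the scan over the k(i) for cumulants
   alpha beta^(m-1) g(k(1), ..., k(m)) with g independent of N. The moments determine the cumulants,
   and N = 1 identifies g with the cumulants of the powers of a. *)

theory Submission
  imports Defs
begin

subsection \<open>Scans\<close>

text \<open>A convolution over all ways to cut a list in two. On a stack the front part is what gets
  popped and the remainder is what the scan goes on with.\<close>

primrec cut_sum :: "('a list \<Rightarrow> complex) \<Rightarrow> ('a list \<Rightarrow> complex) \<Rightarrow> 'a list \<Rightarrow> complex" where
  "cut_sum e F [] = e [] * F []"
| "cut_sum e F (x # l) = e [] * F (x # l) + cut_sum (\<lambda>u. e (x # u)) F l"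

text \<open>The stack has its topmost letter first, hence the reversal.\<close>

primrec scan :: "('a list \<Rightarrow> complex) \<Rightarrow> 'a list \<Rightarrow> 'a list \<Rightarrow> complex" where
  "scan \<kappa> [] S = (if S = [] then 1 else 0)"
| "scan \<kappa> (b # w) S = scan \<kappa> w (b # S) + cut_sum (\<lambda>U. \<kappa> (rev U @ [b])) (scan \<kappa> w) S"

lemma cut_sum_eq_sum: "cut_sum e F l = (\<Sum>j\<le>length l. e (take j l) * F (drop j l))"
  by (induction l arbitrary: e) (simp_all add: sum.atMost_Suc_shift del: sum.atMost_Suc)

lemma cut_sum_add_left: "cut_sum (\<lambda>u. e u + e' u) F l = cut_sum e F l + cut_sum e' F l"
  by (simp add: cut_sum_eq_sum distrib_right sum.distrib)

lemma cut_sum_scale_left: "cut_sum (\<lambda>u. x * e u) F l = x * cut_sum e F l"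
  by (simp add: cut_sum_eq_sum sum_distrib_left mult.assoc)

subsection \<open>Scanning groups of letters\<close>

text \<open>A shape \<open>ps\<close> (topmost group first) represents completed groups of which \<open>q + 1\<close> letters
  are left for each \<open>q\<close> in \<open>ps\<close>; the current group has \<open>p\<close> letters left. \<open>r\<close> letters have been
  popped before, not counting the one that was just read.\<close>

fun pop_sum :: "(nat \<Rightarrow> complex) \<Rightarrow> complex \<Rightarrow> (nat list \<Rightarrow> nat \<Rightarrow> complex) \<Rightarrow>
    nat list \<Rightarrow> nat \<Rightarrow> nat \<Rightarrow> complex" where
  "pop_sum c \<beta> f [] 0 r = c (Suc r) * f [] 0"
| "pop_sum c \<beta> f (q # qs) 0 r = c (Suc r) * f (q # qs) 0 + \<beta> * pop_sum c \<beta> f qs q (Suc r)"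
| "pop_sum c \<beta> f ps (Suc p) r = c (Suc r) * f ps (Suc p) + pop_sum c \<beta> f ps p (Suc r)"

primrec read_letters :: "(nat \<Rightarrow> complex) \<Rightarrow> complex \<Rightarrow> nat \<Rightarrow> (nat list \<Rightarrow> nat \<Rightarrow> complex) \<Rightarrow>
    nat list \<Rightarrow> nat \<Rightarrow> complex" where
  "read_letters c \<beta> 0 f ps p = f ps p"
| "read_letters c \<beta> (Suc k) f ps p =
    read_letters c \<beta> k f ps (Suc p) + pop_sum c \<beta> (read_letters c \<beta> k f) ps p 0"

text \<open>With \<open>\<alpha> = 0\<close> a group without remaining letters kills its summand, so
  \<open>close_group 0\<close> restricts a sum to histories in which no component is
  emptied.\<close>

definition close_group :: "complex \<Rightarrow> (nat list \<Rightarrow> complex) \<Rightarrow> nat list \<Rightarrow> nat \<Rightarrow> complex" where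
  "close_group \<alpha> F ps p = (case p of 0 \<Rightarrow> \<alpha> * F ps | Suc q \<Rightarrow> F (q # ps))"

primrec shape_moment :: "(nat \<Rightarrow> complex) \<Rightarrow> complex \<Rightarrow> complex \<Rightarrow> nat list \<Rightarrow> nat list \<Rightarrow> complex" where
  "shape_moment c \<alpha> \<beta> [] ps = (if ps = [] then 1 else 0)"
| "shape_moment c \<alpha> \<beta> (k # ks) ps =
    read_letters c \<beta> k (close_group \<alpha> (shape_moment c \<alpha> \<beta> ks)) ps 0"

text \<open>The sum over the shapes that are reached from the empty one by reading the groups \<open>ks\<close> (last
  group first) such that no component is ever emptied.\<close>

primrec open_sum :: "(nat \<Rightarrow> complex) \<Rightarrow> complex \<Rightarrow> nat list \<Rightarrow> (nat list \<Rightarrow> complex) \<Rightarrow> complex" where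
  "open_sum c \<beta> [] f = f []"
| "open_sum c \<beta> (k # ks) f = open_sum c \<beta> ks (\<lambda>ps. read_letters c \<beta> k (close_group 0 f) ps 0)"

definition all_closed :: "nat list \<Rightarrow> nat \<Rightarrow> complex" where
  "all_closed ps p = (if ps = [] \<and> p = 0 then 1 else 0)"

text \<open>Collects the histories with a single connected component: nothing is emptied before the
  last group, and that group clears the stack. \<open>tl (rev ks)\<close> lists the other groups,
  latest first.\<close>

definition group_cumulant :: "(nat \<Rightarrow> complex) \<Rightarrow> complex \<Rightarrow> nat list \<Rightarrow> complex" where
  "group_cumulant c \<beta> ks =
    open_sum c \<beta> (tl (rev ks)) (\<lambda>ps. read_letters c \<beta> (last ks) all_closed ps 0)"

section \<open>Linearity and cutting of the shape sums\<close>

lemma pop_sum_add: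
  "pop_sum c \<beta> (\<lambda>ps p. f ps p + g ps p) ps p r = pop_sum c \<beta> f ps p r + pop_sum c \<beta> g ps p r"
  by (induction c \<beta> f ps p r rule: pop_sum.induct) (simp_all add: algebra_simps)

lemma pop_sum_scale: "pop_sum c \<beta> (\<lambda>ps p. x * f ps p) ps p r = x * pop_sum c \<beta> f ps p r"
  by (induction c \<beta> f ps p r rule: pop_sum.induct) (simp_all add: algebra_simps)

lemma pop_sum_zero: "pop_sum c \<beta> (\<lambda>ps p. 0) ps p r = 0"
  using pop_sum_scale[of c \<beta> 0] by simp

lemma pop_sum_sum:
  "pop_sum c \<beta> (\<lambda>ps p. \<Sum>i\<in>I. f i ps p) ps p r = (\<Sum>i\<in>I. pop_sum c \<beta> (f i) ps p r)"
  by (induction I rule: infinite_finite_induct) (simp_all add: pop_sum_zero pop_sum_add)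

lemma read_letters_add:
  "read_letters c \<beta> k (\<lambda>ps p. f ps p + g ps p) ps p =
    read_letters c \<beta> k f ps p + read_letters c \<beta> k g ps p"
proof (induction k arbitrary: ps p)
  case (Suc k)
  then have eq: "read_letters c \<beta> k (\<lambda>ps p. f ps p + g ps p) =
      (\<lambda>ps p. read_letters c \<beta> k f ps p + read_letters c \<beta> k g ps p)" by blast
  show ?case by (simp add: eq pop_sum_add)
qed simp

lemma read_letters_scale:
  "read_letters c \<beta> k (\<lambda>ps p. x * f ps p) ps p = x * read_letters c \<beta> k f ps p"
proof (induction k arbitrary: ps p)
  case (Suc k)
  then have eq: "read_letters c \<beta> k (\<lambda>ps p. x * f ps p) =
      (\<lambda>ps p. x * read_letters c \<beta> k f ps p)" by blast
  show ?case by (simp add: eq pop_sum_scale distrib_left)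
qed simp

lemma open_sum_add:
  "open_sum c \<beta> ks (\<lambda>ps. f ps + g ps) = open_sum c \<beta> ks f + open_sum c \<beta> ks g"
proof (induction ks arbitrary: f g)
  case (Cons k ks)
  have "close_group 0 (\<lambda>ps. f ps + g ps) = (\<lambda>ps p. close_group 0 f ps p + close_group 0 g ps p)"
    by (intro ext) (simp add: close_group_def split: nat.split)
  then show ?case by (simp add: Cons read_letters_add)
qed simp

lemma open_sum_scale: "open_sum c \<beta> ks (\<lambda>ps. x * f ps) = x * open_sum c \<beta> ks f"
proof (induction ks arbitrary: f)
  case (Cons k ks)
  have "close_group 0 (\<lambda>ps. x * f ps) = (\<lambda>ps p. x * close_group 0 f ps p)"
    by (intro ext) (simp add: close_group_def split: nat.split)
  then show ?case by (simp add: Cons read_letters_scale)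
qed simp

text \<open>Popping works from the top, so whatever lies below a cut made afterwards is untouched
  and the cut can be made beforehand.\<close>

lemma pop_sum_cut_sum:
  "pop_sum c \<beta> (\<lambda>ps p. cut_sum (\<lambda>u. e u p) F ps) ps p r =
    cut_sum (\<lambda>u. pop_sum c \<beta> e u p r) F ps"
proof (induction c \<beta> e ps p r rule: pop_sum.induct)
  case (3 c \<beta> f ps p r)
  then show ?case by (simp add: cut_sum_add_left cut_sum_scale_left)
qed (simp_all add: cut_sum_add_left cut_sum_scale_left algebra_simps)

lemma read_letters_cut_sum:
  "read_letters c \<beta> k (\<lambda>ps p. cut_sum (\<lambda>u. e u p) F ps) ps p =
    cut_sum (\<lambda>u. read_letters c \<beta> k e u p) F ps"
proof (induction k arbitrary: ps p)
  case (Suc k)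
  then have eq: "read_letters c \<beta> k (\<lambda>ps p. cut_sum (\<lambda>u. e u p) F ps) =
      (\<lambda>ps p. cut_sum (\<lambda>u. read_letters c \<beta> k e u p) F ps)" by blast
  show ?case by (simp add: eq pop_sum_cut_sum cut_sum_add_left)
qed simp

text \<open>As no component is emptied, each entry of a shape stems from a contiguous run of groups.
  Cutting the shape is therefore cutting the list of groups, and the later groups never reach below
  the cut.\<close>

lemma open_sum_cut_sum:
  "open_sum c \<beta> ks (cut_sum e F) =
    cut_sum (\<lambda>us. open_sum c \<beta> us e) (\<lambda>vs. open_sum c \<beta> vs F) ks"
proof (induction ks arbitrary: e)
  case (Cons k ks)
  have zero: "cut_sum (\<lambda>u. 0) F ps = 0" for ps
    by (simp add: cut_sum_eq_sum)
  have "close_group 0 (cut_sum e F) = (\<lambda>ps p. e [] * close_group 0 F ps p +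
      cut_sum (\<lambda>u. close_group 0 e u p) F ps)"
    by (intro ext) (simp add: close_group_def zero split: nat.split)
  then show ?case
    by (simp add: read_letters_add read_letters_scale read_letters_cut_sum
        open_sum_add open_sum_scale Cons)
qed simp

lemma cut_sum_delta: "cut_sum (\<lambda>u. if u = [] then x else 0) F l = x * F l"
  by (cases l) (simp_all add: cut_sum_eq_sum sum.atMost_Suc_shift del: sum.atMost_Suc)

lemma group_cumulant_snoc:
  "group_cumulant c \<beta> (rev us @ [k]) = open_sum c \<beta> us (\<lambda>ps. read_letters c \<beta> k all_closed ps 0)"
  by (simp add: group_cumulant_def)

text \<open>A stack \<open>us\<close> of groups stands for all shapes that these groups can leave
  open. The group \<open>k\<close> either keeps letters, so that it is pushed onto
  \<open>us\<close>, or it completes a component made of itself and the topmost groups of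
  \<open>us\<close>, which is a block of the scan.\<close>

lemma shape_moment_eq_scan:
  "scan (\<lambda>us. \<alpha> * group_cumulant c \<beta> us) ks us = open_sum c \<beta> us (shape_moment c \<alpha> \<beta> ks)"
proof (induction ks arbitrary: us)
  case Nil
  show ?case
  proof (cases us)
    case (Cons u us')
    have "close_group 0 (shape_moment c \<alpha> \<beta> []) = (\<lambda>ps p. 0)"
      by (intro ext) (simp add: close_group_def split: nat.split)
    then show ?thesis
      using open_sum_scale[of c \<beta> us' 0 "\<lambda>_. 0"] read_letters_scale[of c \<beta> u 0 "\<lambda>_ _. 0"]
      by (simp add: Cons del: shape_moment.simps(1))
  qed simp
next
  case (Cons k ks)
  let ?F = "shape_moment c \<alpha> \<beta> ks"
  \<comment> \<open>The emptied case is written as a cut whose front part \<open>all_closed\<close>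
    forces to be empty. The cutting lemmas then carry this cut back to a cut of
    \<open>us\<close>.\<close>
  have "close_group \<alpha> ?F = (\<lambda>ps p. close_group 0 ?F ps p +
      \<alpha> * cut_sum (\<lambda>u. all_closed u p) ?F ps)"
    by (intro ext) (auto simp: close_group_def all_closed_def cut_sum_delta cut_sum_eq_sum[of "\<lambda>u. 0"] split: nat.split)
  then have "open_sum c \<beta> us (shape_moment c \<alpha> \<beta> (k # ks)) =
      open_sum c \<beta> (k # us) ?F +
      \<alpha> * open_sum c \<beta> us (cut_sum (\<lambda>u. read_letters c \<beta> k all_closed u 0) ?F)"
    by (simp add: shape_moment.simps(2)[abs_def] read_letters_add read_letters_scale
        read_letters_cut_sum open_sum_add open_sum_scale)
  also have "\<dots> = scan (\<lambda>us. \<alpha> * group_cumulant c \<beta> us) (k # ks) us"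
    by (simp add: open_sum_cut_sum cut_sum_scale_left Cons[abs_def] group_cumulant_snoc)
  finally show ?case ..
qed

section \<open>Dependence on the cost of a merger\<close>

lemma inverse_powers_cancel:
  fixes \<beta> \<gamma> x :: complex
  assumes "\<beta> * \<gamma> = 1"
  shows "\<beta> ^ n * (\<gamma> ^ n * x) = x" "\<gamma> ^ n * (\<beta> ^ n * x) = x"
  using assms by (simp_all add: mult.commute[of \<gamma>] flip: mult.assoc power_mult_distrib)

text \<open>Each merger shortens the shape by one, so the exponent of \<open>\<beta>\<close> is the
  drop in length. The inverse \<open>\<gamma>\<close> splits this power into one for the initial and
  one for the final shape.\<close>

lemma pop_sum_rescale:
  assumes "\<beta> * \<gamma> = 1"
  shows "pop_sum c \<beta> f ps p r = \<beta> ^ length ps * pop_sum c 1 (\<lambda>ps p. \<gamma> ^ length ps * f ps p) ps p r"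
  using assms
proof (induction c \<beta> f ps p r rule: pop_sum.induct)
  case (2 c \<beta> f q qs r)
  then show ?case
    using inverse_powers_cancel(1)[OF 2(2), of "Suc (length qs)" "f (q # qs) 0"]
    by (simp add: distrib_left mult.left_commute[of _ "c _"])
next
  case (3 c \<beta> f ps p r)
  then show ?case
    by (simp add: distrib_left mult.left_commute[of _ "c _"] inverse_powers_cancel)
qed simp

lemma read_letters_rescale:
  assumes "\<beta> * \<gamma> = 1"
  shows "read_letters c \<beta> k f ps p =
    \<beta> ^ length ps * read_letters c 1 k (\<lambda>ps p. \<gamma> ^ length ps * f ps p) ps p"
proof (induction k arbitrary: ps p)
  case 0
  show ?case by (simp add: inverse_powers_cancel[OF assms])
next
  case (Suc k)
  let ?g = "read_letters c 1 k (\<lambda>ps p. \<gamma> ^ length ps * f ps p)"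
  have "pop_sum c \<beta> (read_letters c \<beta> k f) ps p 0 =
      \<beta> ^ length ps * pop_sum c 1 (\<lambda>ps p. \<gamma> ^ length ps * read_letters c \<beta> k f ps p) ps p 0"
    by (rule pop_sum_rescale[OF assms])
  also have "(\<lambda>ps p. \<gamma> ^ length ps * read_letters c \<beta> k f ps p) = ?g"
    by (intro ext) (subst Suc, simp add: inverse_powers_cancel[OF assms])
  finally show ?case by (simp add: Suc[of ps "Suc p"] distrib_left)
qed

text \<open>Each group adds one entry to the shape and each merger removes one, which counts the
  mergers.\<close>

lemma open_sum_rescale:
  assumes "\<beta> * \<gamma> = 1"
  shows "open_sum c \<beta> ks f = \<beta> ^ length ks * open_sum c 1 ks (\<lambda>ps. \<gamma> ^ length ps * f ps)"
proof (induction ks arbitrary: f)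
  case (Cons k ks)
  let ?g = "close_group 0 (\<lambda>ps. \<gamma> ^ length ps * f ps)"
  have "(\<lambda>ps p. \<gamma> ^ length ps * close_group 0 f ps p) = (\<lambda>ps p. \<beta> * ?g ps p)"
    using assms by (intro ext) (simp add: close_group_def split: nat.split flip: mult.assoc)
  then have "(\<lambda>ps. \<gamma> ^ length ps * read_letters c \<beta> k (close_group 0 f) ps 0) =
      (\<lambda>ps. \<beta> * read_letters c 1 k ?g ps 0)"
    by (subst read_letters_rescale[OF assms]) (simp add: inverse_powers_cancel[OF assms] read_letters_scale)
  then show ?case by (simp add: Cons open_sum_scale)
qed simp

text \<open>Only the empty final shape passes \<open>all_closed\<close>, so joining nonempty
  \<open>ks\<close> takes exactly \<open>length ks - 1\<close> mergers.\<close>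

lemma group_cumulant_rescale:
  assumes "\<beta> * \<gamma> = 1"
  shows "group_cumulant c \<beta> ks = \<beta> ^ (length ks - 1) * group_cumulant c 1 ks"
proof -
  have "(\<lambda>ps p. \<gamma> ^ length ps * all_closed ps p) = all_closed"
    by (intro ext) (simp add: all_closed_def)
  then have "(\<lambda>ps. \<gamma> ^ length ps * read_letters c \<beta> k all_closed ps 0) =
      (\<lambda>ps. read_letters c 1 k all_closed ps 0)" for k
    by (subst read_letters_rescale[OF assms]) (simp add: inverse_powers_cancel[OF assms])
  then show ?thesis
    unfolding group_cumulant_def by (subst open_sum_rescale[OF assms]) simp
qed

text \<open>Blocks of a partition are sets of positions, blocks of a scan are lists of letters; this
  translates between them.\<close>

lemma nths_set_sorted:
  assumes "sorted_wrt (<) is" and "\<forall>i\<in>set is. i < length bs"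
  shows "nths bs (set is) = map ((!) bs) is"
proof -
  have "nths bs (set is) = map ((!) bs) (nths [0..<length bs] (set is))"
    by (simp add: map_nth flip: nths_map)
  moreover have "nths [0..<length bs] (set is) = is"
  proof (rule strict_sorted_equal)
    show "sorted_wrt (<) (nths [0..<length bs] (set is))"
      by (simp add: strict_sorted_iff sorted_nths distinct_nthsI)
    show "set (nths [0..<length bs] (set is)) = set is"
      using assms(2) by (force simp: set_nths)
  qed (fact assms(1))
  ultimately show ?thesis by simp
qed

subsection \<open>Noncrossing partitions as scans\<close>

text \<open>The partitions that remain to be completed when the positions before \<open>s\<close> have been read
  and \<open>I\<close> is the set of positions on the stack.\<close>

definition pending_NC :: "nat \<Rightarrow> nat set \<Rightarrow> nat \<Rightarrow> nat set set set" where
  "pending_NC n I s = {P. partition_on (I \<union> {s..<n}) P \<and> noncrossing P \<and> (\<forall>V\<in>P. \<exists>v\<in>V. s \<le> v)}"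

lemma finite_pending_NC: "finite I \<Longrightarrow> finite (pending_NC n I s)"
  by (rule finite_subset[OF _ finitely_many_partition_on[of "I \<union> {s..<n}"]])
    (auto simp: pending_NC_def)

lemma pending_NC_finished:
  assumes "\<forall>i\<in>I. i < n"
  shows "pending_NC n I n = (if I = {} then {{}} else {})"
proof -
  have "P = {} \<and> I = {}" if "P \<in> pending_NC n I n" for P
  proof -
    have P: "partition_on I P" "\<forall>V\<in>P. \<exists>v\<in>V. n \<le> v"
      using that by (auto simp: pending_NC_def)
    have "V \<notin> P" for V
    proof
      assume "V \<in> P"
      moreover from this have "V \<subseteq> I" using partition_onD1[OF P(1)] by blast
      ultimately show False using P(2) assms by (meson not_less subsetD)
    qed
    then have "P = {}" by blast
    then show ?thesis using partition_onD1[OF P(1)] by simp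
  qed
  moreover have "{} \<in> pending_NC n {} n" by (simp add: pending_NC_def noncrossing_def partition_on_def)
  ultimately show ?thesis by auto
qed

text \<open>The smaller family holds the partitions in which the block of \<open>s\<close> continues
  beyond \<open>s\<close>, that is, in which \<open>s\<close> is pushed.\<close>

lemma pending_NC_extend:
  assumes "s < n"
  shows "pending_NC n (insert s I) (Suc s) \<subseteq> pending_NC n I s"
proof -
  have "insert s I \<union> {Suc s..<n} = I \<union> {s..<n}" using assms by auto
  then show ?thesis by (auto simp: pending_NC_def) (meson Suc_leD)
qed

text \<open>The points outside the new block lie below all of it or above \<open>s\<close>, never
  between two of its elements, so it crosses nothing.\<close>

lemma insert_top_block_in_pending_NC:
  assumes s: "s < n" and I: "\<forall>i\<in>J \<union> U. i < s" and JU: "\<forall>j\<in>J. \<forall>u\<in>U. j < u"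
    and P: "P \<in> pending_NC n J (Suc s)"
  shows "insert (insert s U) P \<in> pending_NC n (J \<union> U) s - pending_NC n (insert s (J \<union> U)) (Suc s)"
proof -
  let ?V = "insert s U"
  have part: "partition_on (J \<union> {Suc s..<n}) P" and nc: "noncrossing P"
    and reach: "\<forall>V\<in>P. \<exists>v\<in>V. Suc s \<le> v"
    using P by (auto simp: pending_NC_def)
  have disj: "disjnt ?V (J \<union> {Suc s..<n})"
  proof -
    have "x \<noteq> y" if "x \<in> J \<union> {Suc s..<n}" "y \<in> ?V" for x y
    proof -
      have "x < s \<or> s < x" "y \<le> s" using that bspec[OF I, of x] bspec[OF I, of y] by auto
      moreover have "x < y" if "x < s"
        using that \<open>x \<in> _\<close> \<open>y \<in> _\<close> JU by auto
      ultimately show ?thesis by auto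
    qed
    then show ?thesis unfolding disjnt_iff by blast
  qed
  have "partition_on (J \<union> {Suc s..<n} \<union> ?V) (insert ?V P)"
  proof (subst partition_on_insert)
    show "disjnt ?V (\<Union>P)" using disj partition_onD1[OF part] by simp
    have "J \<union> {Suc s..<n} \<union> ?V - ?V = J \<union> {Suc s..<n}"
      using disj unfolding disjnt_def by blast
    then show "partition_on (J \<union> {Suc s..<n} \<union> ?V - ?V) P \<and>
        ?V \<subseteq> J \<union> {Suc s..<n} \<union> ?V \<and> ?V \<noteq> {}" using part by auto
  qed
  moreover have "J \<union> {Suc s..<n} \<union> ?V = J \<union> U \<union> {s..<n}" using s by auto
  moreover have "noncrossing (insert ?V P)"
  proof -
    have out: "j < u \<or> s < j" if "W \<in> P" "j \<in> W" "u \<in> ?V" for W j u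
    proof -
      have "j \<in> J \<union> {Suc s..<n}" using that partition_onD1[OF part] by blast
      then show ?thesis using JU I that(3) by auto
    qed
    have le: "u \<le> s" if "u \<in> ?V" for u using that bspec[OF I, of u] by auto
    have "V = W" if VW: "V \<in> insert ?V P" "W \<in> insert ?V P" and "i \<in> V" "j \<in> W" "k \<in> V" "l \<in> W"
      "i < j" "j < k" "k < l" for V W i j k l
    proof -
      consider "V \<in> P" "W \<in> P" | "V = ?V" "W \<in> P" | "V \<in> P" "W = ?V" | "V = ?V" "W = ?V"
        using VW by blast
      then show ?thesis
      proof cases
        case 1
        then show ?thesis using nc[unfolded noncrossing_def, rule_format, of V W i j k l] that by blast
      next
        case 2
        then show ?thesis using out[of W j i] le[of k] that by auto
      next
        case 3
        then show ?thesis using out[of V k j] le[of l] that by auto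
      qed simp
    qed
    then show ?thesis unfolding noncrossing_def by blast
  qed
  moreover have "\<forall>V\<in>insert ?V P. \<exists>v\<in>V. s \<le> v" using reach by (auto dest: Suc_leD)
  moreover have "\<not> (\<exists>v\<in>?V. Suc s \<le> v)"
  proof
    assume "\<exists>v\<in>?V. Suc s \<le> v"
    then obtain v where "v \<in> ?V" "Suc s \<le> v" by blast
    then show False using bspec[OF I, of v] by auto
  qed
  ultimately show ?thesis by (auto simp: pending_NC_def)
qed

text \<open>Conversely, a block that ends at \<open>s\<close> takes the topmost stack positions: if
  \<open>u < j\<close> with \<open>u\<close> in it and \<open>j\<close> not, then the block of
  \<open>j\<close> reaches some \<open>w > s\<close>, and \<open>u < j < s < w\<close> is a
  crossing.\<close>

lemma top_block_of_pending_NC: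
  assumes s: "s < n" and I: "\<forall>i\<in>I. i < s"
    and P: "P \<in> pending_NC n I s - pending_NC n (insert s I) (Suc s)"
  obtains J U P' where "I = J \<union> U" "\<forall>j\<in>J. \<forall>u\<in>U. j < u" "P' \<in> pending_NC n J (Suc s)"
    "P = insert (insert s U) P'"
proof -
  have part: "partition_on (I \<union> {s..<n}) P" and nc: "noncrossing P"
    and reach: "\<forall>V\<in>P. \<exists>v\<in>V. s \<le> v"
    using P by (auto simp: pending_NC_def)
  have "insert s I \<union> {Suc s..<n} = I \<union> {s..<n}" using s by auto
  \<comment> \<open>The only way not to be in the smaller family is to have a block that stops
    before \<open>Suc s\<close>. Since every block reaches \<open>s\<close>, its maximum is
    \<open>s\<close>.\<close>
  then obtain V where V: "V \<in> P" "\<forall>v\<in>V. \<not> Suc s \<le> v"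
    using P part nc by (auto simp: pending_NC_def)
  then have le: "v \<le> s" if "v \<in> V" for v using that by (auto simp: not_less_eq_eq)
  then have sV: "s \<in> V" using reach V(1) by (metis le_antisym)
  define U where "U = V - {s}"
  define J where "J = I - V"
  have VU: "V = insert s U" using sV by (auto simp: U_def)
  have other: "\<exists>w\<in>W. s < w" if "W \<in> P" "W \<noteq> V" for W
  proof -
    have "s \<notin> W" using partition_onD2[OF part] that V(1) sV by (auto simp: disjoint_def)
    then show ?thesis using reach that(1) by (metis le_neq_implies_less)
  qed
  have "U \<subseteq> I"
  proof
    fix u assume "u \<in> U"
    moreover from this have "u \<in> I \<union> {s..<n}"
      using partition_onD1[OF part] V(1) by (auto simp: U_def)
    ultimately show "u \<in> I" using le[of u] by (auto simp: U_def)
  qed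
  then have IJU: "I = J \<union> U" using I by (auto simp: J_def U_def)
  have below: "j < u" if "j \<in> J" "u \<in> U" for j u
  proof (rule ccontr)
    assume "\<not> j < u"
    moreover have "j \<noteq> u" using that by (auto simp: J_def U_def)
    ultimately have "u < j" by simp
    have "j \<in> \<Union>P" using that(1) partition_onD1[OF part] by (auto simp: J_def)
    then obtain W where W: "W \<in> P" "j \<in> W" by blast
    then have "W \<noteq> V" using that(1) by (auto simp: J_def)
    then obtain w where "w \<in> W" "s < w" using other W by blast
    moreover have "j < s" using that(1) I by (auto simp: J_def)
    ultimately have "V = W"
      using nc V(1) W that(2) sV \<open>u < j\<close> unfolding noncrossing_def U_def by blast
    then show False using \<open>W \<noteq> V\<close> by simp
  qed
  have ground: "I \<union> {s..<n} - V = J \<union> {Suc s..<n}"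
  proof
    show "I \<union> {s..<n} - V \<subseteq> J \<union> {Suc s..<n}"
      using sV by (auto simp: J_def Suc_le_eq intro: le_neq_implies_less)
    show "J \<union> {Suc s..<n} \<subseteq> I \<union> {s..<n} - V"
      using le by (auto simp: J_def not_less_eq_eq[symmetric])
  qed
  have "partition_on (I \<union> {s..<n} - V) (P - {V})"
    using part V(1) unfolding partition_on_def disjoint_def by blast
  moreover have "noncrossing (P - {V})" using nc unfolding noncrossing_def by blast
  moreover have "\<forall>W\<in>P - {V}. \<exists>w\<in>W. Suc s \<le> w" using other by (auto simp: Suc_le_eq)
  ultimately have rest: "P - {V} \<in> pending_NC n J (Suc s)"
    by (simp add: pending_NC_def ground)
  have "P = insert (insert s U) (P - {V})" using V(1) by (simp add: insert_absorb flip: VU)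
  then show thesis using that[OF IJU _ rest] below by simp
qed

lemma take_drop_above:
  assumes xs: "sorted_wrt (>) xs" and JU: "set xs = J \<union> U" "\<forall>j\<in>J. \<forall>u\<in>U. j < (u::nat)"
  shows "\<exists>m\<le>length xs. U = set (take m xs) \<and> J = set (drop m xs)"
  using assms
proof (induction xs arbitrary: J U)
  case (Cons x xs)
  have x: "\<forall>y\<in>set xs. y < x" using Cons.prems(1) by auto
  show ?case
  proof (cases "x \<in> U")
    case True
    then have "x \<notin> J" using Cons.prems(3) by auto
    then have "set xs = J \<union> (U - {x})" using Cons.prems(2) x by auto
    then obtain m where "m \<le> length xs" "U - {x} = set (take m xs)" "J = set (drop m xs)"
      using Cons.IH[of J "U - {x}"] Cons.prems by auto
    then show ?thesis using True by (intro exI[of _ "Suc m"]) auto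
  next
    case False
    then have "x \<in> J" using Cons.prems(2) by auto
    then have "U = {}" using Cons.prems(2,3) x by fastforce
    then show ?thesis using Cons.prems(2) by (intro exI[of _ 0]) auto
  qed
qed simp

text \<open>\<open>m\<close> counts the letters popped together with \<open>s\<close>, which makes
  this union the counterpart of \<open>cut_sum\<close> for sets of partitions.\<close>

lemma top_block_decomposition:
  assumes s: "s < n" and xs: "sorted_wrt (>) xs" "\<forall>i\<in>set xs. i < s"
  shows "pending_NC n (set xs) s - pending_NC n (insert s (set xs)) (Suc s) =
    (\<Union>m\<le>length xs. insert (insert s (set (take m xs))) ` pending_NC n (set (drop m xs)) (Suc s))"
    (is "?L = ?R")
proof
  show "?L \<subseteq> ?R"
  proof
    fix P assume "P \<in> ?L"
    then obtain J U P' where *: "set xs = J \<union> U" "\<forall>j\<in>J. \<forall>u\<in>U. j < u"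
        "P' \<in> pending_NC n J (Suc s)" "P = insert (insert s U) P'"
      using top_block_of_pending_NC[OF s xs(2)] by blast
    with take_drop_above[OF xs(1) *(1,2)] show "P \<in> ?R" by blast
  qed
  show "?R \<subseteq> ?L"
  proof
    fix P assume "P \<in> ?R"
    then obtain m P' where m: "m \<le> length xs" "P' \<in> pending_NC n (set (drop m xs)) (Suc s)"
        "P = insert (insert s (set (take m xs))) P'" by blast
    have un: "set (drop m xs) \<union> set (take m xs) = set xs"
      by (metis append_take_drop_id set_append sup_commute)
    have "\<forall>j\<in>set (drop m xs). \<forall>u\<in>set (take m xs). j < u"
      using xs(1) by (metis append_take_drop_id sorted_wrt_append)
    with insert_top_block_in_pending_NC[OF s _ this m(2)] show "P \<in> ?L"
      using xs(2) un m(3) by simp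
  qed
qed

text \<open>Induction on the number of unread positions. Pushing \<open>s\<close> and completing a
  block at \<open>s\<close> are the two summands in the recursion of \<open>scan\<close>.\<close>

lemma sum_pending_NC_eq_scan:
  assumes "s \<le> length bs" and "sorted_wrt (>) xs" and "\<forall>i\<in>set xs. i < s"
  shows "(\<Sum>P\<in>pending_NC (length bs) (set xs) s. \<Prod>V\<in>P. \<kappa> (nths bs V)) =
    scan \<kappa> (drop s bs) (map ((!) bs) xs)"
  using assms
proof (induction "length bs - s" arbitrary: s xs)
  case 0
  then have "s = length bs" by simp
  with 0 show ?case by (simp add: pending_NC_finished)
next
  case (Suc d)
  let ?n = "length bs" and ?w = "\<lambda>P. \<Prod>V\<in>P. \<kappa> (nths bs V)"
  let ?V = "\<lambda>m. insert s (set (take m xs))"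
  have s: "s < ?n" "d = ?n - Suc s" using Suc.hyps(2) by auto
  have take: "\<forall>i\<in>set (take m xs). i < s" and drop: "\<forall>i\<in>set (drop m xs). i < s" for m
    using Suc.prems(3) by (meson in_set_takeD, meson in_set_dropD)
  have fresh: "?V m \<notin> P" if "P \<in> pending_NC ?n (set (drop m xs)) (Suc s)" for m P
  proof
    assume "?V m \<in> P"
    moreover have "\<Union>P = set (drop m xs) \<union> {Suc s..<?n}"
      using that by (simp add: pending_NC_def partition_on_def)
    ultimately have "s \<in> set (drop m xs) \<union> {Suc s..<?n}" by blast
    then show False using drop[of m] by auto
  qed
  have fin: "finite P" if "P \<in> pending_NC ?n (set (drop m xs)) (Suc s)" for m P
  proof -
    have "partition_on (set (drop m xs) \<union> {Suc s..<?n}) P"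
      using that by (simp add: pending_NC_def)
    then show ?thesis by (rule finite_elements[rotated]) simp
  qed
  have blk: "\<kappa> (nths bs (?V m)) = \<kappa> (rev (map ((!) bs) (take m xs)) @ [bs ! s])" for m
  proof -
    have "sorted_wrt (<) (rev (take m xs) @ [s])"
      using sorted_wrt_take[OF Suc.prems(2)] take[of m] by (simp add: sorted_wrt_append sorted_wrt_rev)
    moreover have "\<forall>i\<in>set (rev (take m xs) @ [s]). i < ?n"
      using take[of m] s(1) by (simp add: ball_Un) (meson less_trans)
    ultimately have "nths bs (set (rev (take m xs) @ [s])) = map ((!) bs) (rev (take m xs) @ [s])"
      by (rule nths_set_sorted)
    then show ?thesis by (simp add: rev_map)
  qed
  \<comment> \<open>The block that contains \<open>s\<close> determines \<open>m\<close>, because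
    the stack has no repetitions.\<close>
  have disj: "insert (?V m) ` pending_NC ?n (set (drop m xs)) (Suc s) \<inter>
      insert (?V m') ` pending_NC ?n (set (drop m' xs)) (Suc s) = {}"
    if mm: "m \<le> length xs" "m' \<le> length xs" "m \<noteq> m'" for m m'
  proof -
    have False if P: "P \<in> pending_NC ?n (set (drop m xs)) (Suc s)"
      "P' \<in> pending_NC ?n (set (drop m' xs)) (Suc s)" "insert (?V m) P = insert (?V m') P'" for P P'
    proof -
      have "\<Union>P' = set (drop m' xs) \<union> {Suc s..<?n}"
        using P(2) by (simp add: pending_NC_def partition_on_def)
      then have "s \<notin> \<Union>P'" using drop[of m'] by auto
      then have "?V m \<notin> P'" by (meson UnionI insertI1)
      moreover have "?V m \<in> insert (?V m') P'" using P(3) by (metis insertI1)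
      ultimately have "?V m = ?V m'" by simp
      moreover have "s \<notin> set (take m xs)" "s \<notin> set (take m' xs)"
        using take[of m] take[of m'] by blast+
      ultimately have "set (take m xs) = set (take m' xs)" by (simp add: insert_ident)
      moreover have "distinct xs" using Suc.prems(2) sorted_wrt_rev[of "(<)" xs] strict_sorted_iff[of "rev xs"] by simp
      ultimately have "length (take m xs) = length (take m' xs)"
        by (metis distinct_card distinct_take)
      then show False using mm by simp
    qed
    then show ?thesis by blast
  qed
  have inj: "inj_on (insert (?V m)) (pending_NC ?n (set (drop m xs)) (Suc s))" for m
  proof (rule inj_onI)
    fix P P'
    assume P: "P \<in> pending_NC ?n (set (drop m xs)) (Suc s)"
      "P' \<in> pending_NC ?n (set (drop m xs)) (Suc s)" "insert (?V m) P = insert (?V m) P'"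
    show "P = P'" using P(3) insert_ident[OF fresh[OF P(1)] fresh[OF P(2)]] by simp
  qed
  have "sum ?w (pending_NC ?n (set xs) s) = sum ?w (pending_NC ?n (insert s (set xs)) (Suc s)) +
      sum ?w (pending_NC ?n (set xs) s - pending_NC ?n (insert s (set xs)) (Suc s))"
    using sum.subset_diff[OF pending_NC_extend[OF s(1)] finite_pending_NC[OF finite_set], of ?w]
    by (simp only: add.commute)
  also have "sum ?w (pending_NC ?n (insert s (set xs)) (Suc s)) =
      scan \<kappa> (drop (Suc s) bs) (map ((!) bs) (s # xs))"
    using Suc.hyps(1)[OF s(2), of "s # xs"] s Suc.prems by (auto simp: less_Suc_eq)
  also have "sum ?w (pending_NC ?n (set xs) s - pending_NC ?n (insert s (set xs)) (Suc s)) =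
      (\<Sum>m\<le>length xs. sum ?w (insert (?V m) ` pending_NC ?n (set (drop m xs)) (Suc s)))"
    unfolding top_block_decomposition[OF s(1) Suc.prems(2,3)]
    using disj by (intro sum.UNION_disjoint) (auto simp: finite_pending_NC)
  also have "\<dots> = (\<Sum>m\<le>length xs. \<kappa> (rev (map ((!) bs) (take m xs)) @ [bs ! s]) *
      scan \<kappa> (drop (Suc s) bs) (map ((!) bs) (drop m xs)))"
  proof (rule sum.cong[OF refl])
    fix m
    have "sum ?w (insert (?V m) ` pending_NC ?n (set (drop m xs)) (Suc s)) =
        (\<Sum>P\<in>pending_NC ?n (set (drop m xs)) (Suc s). ?w (insert (?V m) P))"
      by (simp only: sum.reindex[OF inj] o_def)
    also have "\<dots> = \<kappa> (nths bs (?V m)) * sum ?w (pending_NC ?n (set (drop m xs)) (Suc s))"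
      by (simp add: sum_distrib_left fin fresh)
    also have "sum ?w (pending_NC ?n (set (drop m xs)) (Suc s)) =
        scan \<kappa> (drop (Suc s) bs) (map ((!) bs) (drop m xs))"
      using s drop[of m] Suc.prems(2) by (intro Suc.hyps(1)) (auto simp: sorted_wrt_drop less_SucI)
    finally show "sum ?w (insert (?V m) ` pending_NC ?n (set (drop m xs)) (Suc s)) =
        \<kappa> (rev (map ((!) bs) (take m xs)) @ [bs ! s]) *
        scan \<kappa> (drop (Suc s) bs) (map ((!) bs) (drop m xs))"
      by (simp only: blk)
  qed
  also have "scan \<kappa> (drop (Suc s) bs) (map ((!) bs) (s # xs)) + \<dots> =
      scan \<kappa> (drop s bs) (map ((!) bs) xs)"
    using s(1) by (simp add: cut_sum_eq_sum take_map drop_map flip: Cons_nth_drop_Suc)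
  finally show ?case .
qed

lemma sum_NC_eq_scan: "(\<Sum>P\<in>NC (length bs). \<Prod>V\<in>P. \<kappa> (nths bs V)) = scan \<kappa> bs []"
proof -
  \<comment> \<open>Before anything is read, the condition that blocks reach position 0 or later
    only says that they are nonempty.\<close>
  have "NC (length bs) = pending_NC (length bs) (set []) 0"
    by (auto simp: NC_def pending_NC_def lessThan_atLeast0 dest: partition_onD3)
      (metis ex_in_conv partition_onD3)
  then show ?thesis using sum_pending_NC_eq_scan[of 0 bs "[]" \<kappa>] by simp
qed

text \<open>Moments determine cumulants, here for functions on lists over any type. It will be
  applied to lists of exponents, where no product of the letters is at hand.\<close>

lemma scan_unique:
  assumes "\<And>bs. scan \<kappa> bs [] = scan \<kappa>' bs []" and "bs \<noteq> []"
  shows "\<kappa> bs = \<kappa>' bs"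
  using assms(2)
proof (induction "length bs" arbitrary: bs rule: less_induct)
  case less
  let ?n = "length bs" and ?rest = "NC (length bs) - {{{..<length bs}}}"
  have split: "scan g bs [] = g bs + (\<Sum>P\<in>?rest. \<Prod>V\<in>P. g (nths bs V))" for g
    using less.prems one_block_in_NC[of ?n]
    by (simp add: finite_NC nths_all sum.remove flip: sum_NC_eq_scan)
  have "(\<Prod>V\<in>P. \<kappa> (nths bs V)) = (\<Prod>V\<in>P. \<kappa>' (nths bs V))" if P: "P \<in> ?rest" for P
  proof (rule prod.cong)
    fix V assume V: "V \<in> P"
    have sub: "V \<subset> {..<?n}" using NC_proper_block[OF P V] .
    have "V \<noteq> {}" using P V by (auto simp: NC_def partition_on_def)
    then have "set (nths bs V) \<noteq> {}" using sub by (auto simp: set_nths)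
    then have "nths bs V \<noteq> []" by auto
    then show "\<kappa> (nths bs V) = \<kappa>' (nths bs V)"
      using less.hyps length_nths_proper[OF sub] by blast
  qed simp
  then have "(\<Sum>P\<in>?rest. \<Prod>V\<in>P. \<kappa> (nths bs V)) = (\<Sum>P\<in>?rest. \<Prod>V\<in>P. \<kappa>' (nths bs V))"
    by (rule sum.cong[OF refl])
  then show ?case using assms(1)[of bs] by (simp add: split)
qed

lemma state_prod_list_eq_scan:
  assumes "\<phi> 1 = 1"
  shows "\<phi> (prod_list bs) = scan (free_cumulant \<phi>) bs []"
proof (cases "bs = []")
  case False
  then show ?thesis by (simp add: moment_cumulant_formula sum_NC_eq_scan)
qed (simp add: assms)

subsection \<open>Sums over indices\<close>

text \<open>A sum over the words of index pairs along all index paths of length \<open>k\<close> from \<open>y\<close> to \<open>x\<close>.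
  With \<open>pr = Pair\<close> these are the words that occur in an entry of a matrix power; with the swapped
  pair they are the same words as they appear on a stack, that is, reversed.\<close>

fun chain :: "nat \<Rightarrow> (nat \<Rightarrow> nat \<Rightarrow> 'p) \<Rightarrow> nat \<Rightarrow> nat \<Rightarrow> nat \<Rightarrow> ('p list \<Rightarrow> complex) \<Rightarrow> complex" where
  "chain N pr 0 y x f = (if y = x then f [] else 0)"
| "chain N pr (Suc k) y x f = (\<Sum>z<N. chain N pr k z x (\<lambda>w. f (pr y z # w)))"

primrec loops :: "nat \<Rightarrow> (nat \<Rightarrow> nat \<Rightarrow> 'p) \<Rightarrow> nat list \<Rightarrow> ('p list \<Rightarrow> complex) \<Rightarrow> complex" where
  "loops N pr [] f = f []"
| "loops N pr (k # ks) f = (\<Sum>x<N. chain N pr k x x (\<lambda>u. loops N pr ks (\<lambda>v. f (u @ v))))"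

text \<open>The situation in the middle of a trace with first index \<open>x\<close>. For
  \<open>Pair\<close> these are the letters still to be read, leading from \<open>y\<close> back to
  \<open>x\<close> and followed by the later traces; for the swapped pair they are the letters on
  the stack, read downwards from \<open>y\<close> to \<open>x\<close>, above those of the earlier
  traces.\<close>

definition chain_loops :: "nat \<Rightarrow> (nat \<Rightarrow> nat \<Rightarrow> 'p) \<Rightarrow> nat list \<Rightarrow> nat \<Rightarrow> nat \<Rightarrow> nat \<Rightarrow>
    ('p list \<Rightarrow> complex) \<Rightarrow> complex" where
  "chain_loops N pr ks k y x f = chain N pr k y x (\<lambda>u. loops N pr ks (\<lambda>v. f (u @ v)))"

lemma chain_add: "chain N pr k y x (\<lambda>w. f w + g w) = chain N pr k y x f + chain N pr k y x g"
  by (induction k arbitrary: y f g) (simp_all add: sum.distrib)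

lemma chain_scale: "chain N pr k y x (\<lambda>w. c * f w) = c * chain N pr k y x f"
  by (induction k arbitrary: y f) (simp_all add: sum_distrib_left)

lemma chain_sum: "chain N pr k y x (\<lambda>w. \<Sum>i\<in>I. f i w) = (\<Sum>i\<in>I. chain N pr k y x (f i))"
proof (induction k arbitrary: y f)
  case (Suc k)
  then show ?case by (simp add: sum.swap[of _ I])
qed simp

lemma loops_add: "loops N pr ks (\<lambda>w. f w + g w) = loops N pr ks f + loops N pr ks g"
  by (induction ks arbitrary: f g) (simp_all add: chain_add sum.distrib)

lemma loops_scale: "loops N pr ks (\<lambda>w. c * f w) = c * loops N pr ks f"
  by (induction ks arbitrary: f) (simp_all add: chain_scale sum_distrib_left)

lemma loops_sum: "loops N pr ks (\<lambda>w. \<Sum>i\<in>I. f i w) = (\<Sum>i\<in>I. loops N pr ks (f i))"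
proof (induction ks arbitrary: f)
  case (Cons k ks)
  then show ?case by (simp add: chain_sum sum.swap[of _ I])
qed simp

lemma chain_loops_add: "chain_loops N pr ks k y x (\<lambda>w. f w + g w) =
    chain_loops N pr ks k y x f + chain_loops N pr ks k y x g"
  by (simp add: chain_loops_def chain_add loops_add)

lemma chain_loops_scale:
  "chain_loops N pr ks k y x (\<lambda>w. c * f w) = c * chain_loops N pr ks k y x f"
  by (simp add: chain_loops_def chain_scale loops_scale)

lemma chain_loops_sum: "chain_loops N pr ks k y x (\<lambda>w. \<Sum>i\<in>I. f i w) =
    (\<Sum>i\<in>I. chain_loops N pr ks k y x (f i))"
  by (simp add: chain_loops_def chain_sum loops_sum)

lemma chain_loops_zero: "chain_loops N pr ks k y x (\<lambda>w. 0) = 0"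
  using chain_loops_scale[of N pr ks k y x 0] by simp

lemma chain_loops_0: "chain_loops N pr ks 0 y x f = (if y = x then loops N pr ks f else 0)"
  by (simp add: chain_loops_def)

lemma chain_loops_Suc: "chain_loops N pr ks (Suc k) y x f =
    (\<Sum>z<N. chain_loops N pr ks k z x (\<lambda>w. f (pr y z # w)))"
  by (simp add: chain_loops_def)

lemma loops_Cons: "loops N pr (k # ks) f = (\<Sum>x<N. chain_loops N pr ks k x x f)"
  by (simp add: chain_loops_def)

lemma chain_cong:
  assumes "\<And>w. set w \<subseteq> {(i, j). i < N \<and> j < N} \<Longrightarrow> f w = g w" and "y < N"
  shows "chain N Pair k y x f = chain N Pair k y x g"
  using assms
proof (induction k arbitrary: y f g)
  case (Suc k)
  have "chain N Pair k z x (\<lambda>w. f ((y, z) # w)) = chain N Pair k z x (\<lambda>w. g ((y, z) # w))"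
    if "z < N" for z
    using that Suc.prems by (intro Suc.IH) auto
  then show ?case by simp
qed simp

lemma loops_cong:
  assumes "\<And>w. set w \<subseteq> {(i, j). i < N \<and> j < N} \<Longrightarrow> f w = g w"
  shows "loops N Pair ks f = loops N Pair ks g"
  using assms
proof (induction ks arbitrary: f g)
  case (Cons k ks)
  have "loops N Pair ks (\<lambda>v. f (u @ v)) = loops N Pair ks (\<lambda>v. g (u @ v))"
    if "set u \<subseteq> {(i, j). i < N \<and> j < N}" for u
    using that Cons.prems by (intro Cons.IH) auto
  then have "chain N Pair k x x (\<lambda>u. loops N Pair ks (\<lambda>v. f (u @ v))) =
      chain N Pair k x x (\<lambda>u. loops N Pair ks (\<lambda>v. g (u @ v)))" if "x < N" for x
    using that by (rule chain_cong)
  then show ?case by simp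
qed simp

lemma cut_sum_chain_loops: "cut_sum e (\<lambda>S. chain_loops N pr ks k y x (F S)) S =
    chain_loops N pr ks k y x (\<lambda>w. cut_sum e (\<lambda>S. F S w) S)"
  by (simp add: cut_sum_eq_sum chain_loops_sum chain_loops_scale)

section \<open>Cyclic words of index pairs\<close>

fun path :: "nat \<Rightarrow> (nat \<times> nat) list \<Rightarrow> nat \<Rightarrow> bool" where
  "path y [] z \<longleftrightarrow> y = z"
| "path y ((i, j) # l) z \<longleftrightarrow> y = i \<and> path j l z"

lemma path_append: "path y (l @ l') z \<longleftrightarrow> (\<exists>m. path y l m \<and> path m l' z)"
  by (induction y l z rule: path.induct) auto

lemma path_end_unique: "path y l z \<Longrightarrow> path y l z' \<Longrightarrow> z = z'"
  by (induction y l z rule: path.induct) auto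

text \<open>With \<open>\<beta> = 1/N\<close> and \<open>c r\<close> the cumulant of
  \<open>r\<close> copies of \<open>a\<close>, these are the cumulants prescribed for the matrix
  entries.\<close>

definition cyclic_weight :: "(nat \<Rightarrow> complex) \<Rightarrow> complex \<Rightarrow> (nat \<times> nat) list \<Rightarrow> complex" where
  "cyclic_weight c \<beta> l =
    (if \<exists>y. path y l y then \<beta> ^ (length l - 1) * c (length l) else 0)"

text \<open>\<open>y\<close> is the first index of the letters popped so far, \<open>z\<close> is their last index, and their
  number is \<open>r + 1\<close>.\<close>

fun cyclic_pop :: "(nat \<Rightarrow> complex) \<Rightarrow> complex \<Rightarrow> ((nat \<times> nat) list \<Rightarrow> complex) \<Rightarrow>
    (nat \<times> nat) list \<Rightarrow> nat \<Rightarrow> nat \<Rightarrow> nat \<Rightarrow> complex" where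
  "cyclic_pop c \<beta> F [] y z r = (if y = z then \<beta> ^ r * c (Suc r) * F [] else 0)"
| "cyclic_pop c \<beta> F ((i, j) # S) y z r =
    (if y = z then \<beta> ^ r * c (Suc r) * F ((i, j) # S) else 0) +
    (if j = y then cyclic_pop c \<beta> F S i z (Suc r) else 0)"

text \<open>A letter that does not fit the index \<open>y\<close> above it spoils every deeper cut
  as well, so the sum over cuts can stop there.\<close>

lemma cut_sum_cyclic_weight:
  assumes "path y l z" and "length l = Suc r"
  shows "cut_sum (\<lambda>U. cyclic_weight c \<beta> (rev U @ l)) F S = cyclic_pop c \<beta> F S y z r"
  using assms
proof (induction S arbitrary: l y r)
  have start: "path y' l z' \<Longrightarrow> y' = y" if "path y l z" "length l = Suc r" for l y y' z' r
    using that by (cases l) auto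
  have weight: "cyclic_weight c \<beta> l = (if y = z then \<beta> ^ r * c (Suc r) else 0)"
    if "path y l z" "length l = Suc r" for l y r
  proof -
    have "(\<exists>y'. path y' l y') \<longleftrightarrow> y = z" using start[OF that] path_end_unique that(1) by metis
    then show ?thesis using that(2) by (simp add: cyclic_weight_def)
  qed
  {
    case Nil
    then show ?case by (simp add: weight)
  next
    case (Cons s S)
    obtain i j where s: "s = (i, j)" by fastforce
    show ?case
    proof (cases "j = y")
      case True
      then show ?thesis using Cons.IH[of i "s # l" "Suc r"] Cons.prems
        by (simp add: s weight)
    next
      case False
      have "cyclic_weight c \<beta> (rev U @ s # l) = 0" for U
        using start[OF Cons.prems] False by (auto simp: cyclic_weight_def path_append s)
      then have "cut_sum (\<lambda>U. cyclic_weight c \<beta> (rev (s # U) @ l)) F S = 0"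
        by (simp add: cut_sum_eq_sum)
      then show ?thesis using False Cons.prems by (simp add: s weight)
    qed
  }
qed

text \<open>Every popped letter brings a factor \<open>\<beta>\<close>. Within a trace the index
  \<open>y\<close> becomes interior to the block and its free sum gives \<open>N\<close>, which
  cancels this factor. At the bottom of a trace \<open>y = x\<close> is fixed, so
  \<open>\<beta>\<close> survives as the cost of a merger; the base index of the next trace must
  then be \<open>x\<close> as well, and what is left of it is again a chain to
  \<open>x\<close>.\<close>

lemma sum_cyclic_pop:
  assumes "of_nat N * \<beta> = 1" and "x < N" and "z < N"
  shows "(\<Sum>y<N. chain_loops N (\<lambda>i j. (j, i)) (map Suc ps) p y x (\<lambda>S. cyclic_pop c \<beta> F S y z r)) =
    \<beta> ^ r * pop_sum c \<beta> (\<lambda>ps p. chain_loops N (\<lambda>i j. (j, i)) (map Suc ps) p z x F) ps p r"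
  using assms(1,2)
proof (induction c \<beta> "\<lambda>ps p. chain_loops N (\<lambda>i j. (j, i)) (map Suc ps) p z x F" ps p r
    rule: pop_sum.induct)
  case (1 c \<beta> r)
  then show ?case using assms(3) by (simp add: chain_loops_0)
next
  case (2 c \<beta> q qs r)
  let ?J = "\<lambda>ps. chain_loops N (\<lambda>i j. (j, i)) (map Suc ps)"
  have "(\<Sum>y<N. ?J (q # qs) 0 y x (\<lambda>S. cyclic_pop c \<beta> F S y z r)) =
      loops N (\<lambda>i j. (j, i)) (map Suc (q # qs)) (\<lambda>S. cyclic_pop c \<beta> F S x z r)"
    using 2 by (simp add: chain_loops_0 del: list.map loops.simps)
  also have "\<dots> = (\<Sum>x'<N. \<Sum>y<N. ?J qs q y x' (\<lambda>S. cyclic_pop c \<beta> F ((y, x') # S) x z r))"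
    by (simp add: loops_Cons chain_loops_Suc del: loops.simps)
  also have "\<dots> = (\<Sum>x'<N. \<Sum>y<N. (if x = z then \<beta> ^ r * c (Suc r) * ?J qs q y x' (\<lambda>S. F ((y, x') # S)) else 0) +
      (if x' = x then ?J qs q y x (\<lambda>S. cyclic_pop c \<beta> F S y z (Suc r)) else 0))"
    by (intro sum.cong refl) (auto simp: chain_loops_add chain_loops_scale chain_loops_zero)
  also have "\<dots> = (if x = z then \<beta> ^ r * c (Suc r) *
        (\<Sum>x'<N. \<Sum>y<N. ?J qs q y x' (\<lambda>S. F ((y, x') # S))) else 0) +
      (\<Sum>y<N. ?J qs q y x (\<lambda>S. cyclic_pop c \<beta> F S y z (Suc r)))"
  proof -
    have "(\<Sum>y<N. if x' = x then b y else 0) = (if x' = x then \<Sum>y<N. b y else 0)"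
      for x' and b :: "nat \<Rightarrow> complex" by simp
    then show ?thesis using 2 by (cases "x = z") (simp_all add: sum.distrib sum_distrib_left)
  qed
  also have "(\<Sum>x'<N. \<Sum>y<N. ?J qs q y x' (\<lambda>S. F ((y, x') # S))) =
      loops N (\<lambda>i j. (j, i)) (map Suc (q # qs)) F"
    by (simp add: loops_Cons chain_loops_Suc del: loops.simps)
  also have "(\<Sum>y<N. ?J qs q y x (\<lambda>S. cyclic_pop c \<beta> F S y z (Suc r))) =
      \<beta> ^ Suc r * pop_sum c \<beta> (\<lambda>ps p. ?J ps p z x F) qs q (Suc r)"
    using 2 by blast
  finally show ?case by (simp add: chain_loops_0 algebra_simps del: list.map loops.simps)
next
  case (3 c \<beta> ps p r)
  let ?J = "\<lambda>ps. chain_loops N (\<lambda>i j. (j, i)) (map Suc ps)"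
  have "(\<Sum>y<N. ?J ps (Suc p) y x (\<lambda>S. cyclic_pop c \<beta> F S y z r)) =
      (\<Sum>y<N. \<Sum>y'<N. (if y = z then \<beta> ^ r * c (Suc r) * ?J ps p y' x (\<lambda>S. F ((y', z) # S)) else 0) +
        ?J ps p y' x (\<lambda>S. cyclic_pop c \<beta> F S y' z (Suc r)))"
    by (intro sum.cong refl) (auto simp: chain_loops_Suc chain_loops_add chain_loops_scale chain_loops_zero intro!: sum.cong)
  \<comment> \<open>The second summand does not involve the outer \<open>y\<close>, hence the factor
    \<open>N\<close>.\<close>
  also have "\<dots> = \<beta> ^ r * c (Suc r) * ?J ps (Suc p) z x F +
      of_nat N * (\<Sum>y<N. ?J ps p y x (\<lambda>S. cyclic_pop c \<beta> F S y z (Suc r)))"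
  proof -
    have "(\<Sum>y'<N. if y = z then b y' else 0) = (if y = z then \<Sum>y'<N. b y' else 0)"
      for y and b :: "nat \<Rightarrow> complex" by simp
    then show ?thesis using assms(3) by (simp add: sum.distrib chain_loops_Suc sum_distrib_left)
  qed
  also have "(\<Sum>y<N. ?J ps p y x (\<lambda>S. cyclic_pop c \<beta> F S y z (Suc r))) =
      \<beta> ^ Suc r * pop_sum c \<beta> (\<lambda>ps p. ?J ps p z x F) ps p (Suc r)"
    using 3 by blast
  also have "of_nat N * \<dots> = \<beta> ^ r * pop_sum c \<beta> (\<lambda>ps p. ?J ps p z x F) ps p (Suc r)"
    using 3(2) by (simp flip: mult.assoc)
  finally show ?case by (simp add: algebra_simps)
qed

text \<open>The current trace has \<open>p\<close> letters on the stack and \<open>k\<close> unread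
  ones, joined at the index \<open>y\<close>. Reading the letter \<open>(y, z)\<close> moves the
  joint to \<open>z\<close>, both when it is pushed and when it closes a block.\<close>

lemma sum_chain_loops_scan_eq:
  assumes N: "of_nat N * \<beta> = 1"
    and loops: "\<And>ps. loops N (\<lambda>i j. (j, i)) (map Suc ps)
        (\<lambda>S. loops N Pair ks (\<lambda>w. scan (cyclic_weight c \<beta>) w S)) = shape_moment c (of_nat N) \<beta> ks ps"
  shows "(\<Sum>x<N. \<Sum>y<N. chain_loops N (\<lambda>i j. (j, i)) (map Suc ps) p y x
        (\<lambda>S. chain_loops N Pair ks k y x (\<lambda>w. scan (cyclic_weight c \<beta>) w S))) =
    read_letters c \<beta> k (close_group (of_nat N) (shape_moment c (of_nat N) \<beta> ks)) ps p"
proof (induction k arbitrary: ps p)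
  let ?J = "\<lambda>ps. chain_loops N (\<lambda>i j. (j, i)) (map Suc ps)"
  let ?\<kappa> = "cyclic_weight c \<beta>"
  case 0
  let ?G = "\<lambda>S. loops N Pair ks (\<lambda>w. scan ?\<kappa> w S)"
  have "(\<Sum>y<N. ?J ps p y x (\<lambda>S. chain_loops N Pair ks 0 y x (\<lambda>w. scan ?\<kappa> w S))) = ?J ps p x x ?G"
    if "x < N" for x
  proof -
    have "?J ps p y x (\<lambda>S. chain_loops N Pair ks 0 y x (\<lambda>w. scan ?\<kappa> w S)) =
        (if y = x then ?J ps p x x ?G else 0)" for y
      by (simp add: chain_loops_0 chain_loops_zero)
    then show ?thesis using that by simp
  qed
  then have "(\<Sum>x<N. \<Sum>y<N. ?J ps p y x (\<lambda>S. chain_loops N Pair ks 0 y x (\<lambda>w. scan ?\<kappa> w S))) =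
      (\<Sum>x<N. ?J ps p x x ?G)" by simp
  also have "\<dots> = close_group (of_nat N) (shape_moment c (of_nat N) \<beta> ks) ps p"
  proof (cases p)
    \<comment> \<open>Nothing depends on \<open>x\<close> any more, so its sum is \<open>N\<close>,
      the trace of the identity.\<close>
    case 0
    then show ?thesis by (simp add: close_group_def chain_loops_0 loops)
  next
    case (Suc q)
    then have "(\<Sum>x<N. ?J ps p x x ?G) = loops N (\<lambda>i j. (j, i)) (map Suc (q # ps)) ?G"
      by (simp add: loops_Cons del: loops.simps)
    then show ?thesis by (simp only: loops) (simp add: close_group_def Suc)
  qed
  finally show ?case by simp
next
  let ?J = "\<lambda>ps. chain_loops N (\<lambda>i j. (j, i)) (map Suc ps)"
  let ?\<kappa> = "cyclic_weight c \<beta>"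
  case (Suc k)
  let ?F = "\<lambda>x z S. chain_loops N Pair ks k z x (\<lambda>w. scan ?\<kappa> w S)"
  let ?R = "read_letters c \<beta> k (close_group (of_nat N) (shape_moment c (of_nat N) \<beta> ks))"
  have step: "chain_loops N Pair ks (Suc k) y x (\<lambda>w. scan ?\<kappa> w S) =
      (\<Sum>z<N. ?F x z ((y, z) # S) + cyclic_pop c \<beta> (?F x z) S y z 0)" for x y S
  proof -
    have "cyclic_pop c \<beta> (?F x z) S y z 0 =
        chain_loops N Pair ks k z x (\<lambda>w. cut_sum (\<lambda>U. ?\<kappa> (rev U @ [(y, z)])) (scan ?\<kappa> w) S)" for z
      by (subst cut_sum_chain_loops[symmetric], subst cut_sum_cyclic_weight[where y = y and z = z and r = 0]) auto
    then show ?thesis by (simp add: chain_loops_Suc chain_loops_add)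
  qed
  have "(\<Sum>y<N. ?J ps p y x (\<lambda>S. chain_loops N Pair ks (Suc k) y x (\<lambda>w. scan ?\<kappa> w S))) =
      (\<Sum>z<N. \<Sum>y<N. ?J ps p y x (\<lambda>S. ?F x z ((y, z) # S)) +
        ?J ps p y x (\<lambda>S. cyclic_pop c \<beta> (?F x z) S y z 0))" for x
    unfolding step chain_loops_sum chain_loops_add by (rule sum.swap)
  then have "(\<Sum>x<N. \<Sum>y<N. ?J ps p y x (\<lambda>S. chain_loops N Pair ks (Suc k) y x (\<lambda>w. scan ?\<kappa> w S))) =
      (\<Sum>x<N. \<Sum>z<N. \<Sum>y<N. ?J ps p y x (\<lambda>S. ?F x z ((y, z) # S))) +
      (\<Sum>x<N. \<Sum>z<N. \<Sum>y<N. ?J ps p y x (\<lambda>S. cyclic_pop c \<beta> (?F x z) S y z 0))"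
    by (simp only: sum.distrib)
  also have "(\<Sum>x<N. \<Sum>z<N. \<Sum>y<N. ?J ps p y x (\<lambda>S. ?F x z ((y, z) # S))) =
      (\<Sum>x<N. \<Sum>z<N. ?J ps (Suc p) z x (?F x z))"
    by (simp only: chain_loops_Suc)
  also have "\<dots> = ?R ps (Suc p)" by (rule Suc)
  also have "(\<Sum>x<N. \<Sum>z<N. \<Sum>y<N. ?J ps p y x (\<lambda>S. cyclic_pop c \<beta> (?F x z) S y z 0)) =
      (\<Sum>x<N. \<Sum>z<N. pop_sum c \<beta> (\<lambda>ps p. ?J ps p z x (?F x z)) ps p 0)"
    using sum_cyclic_pop[OF N, where r = 0] by (intro sum.cong refl) simp
  also have "\<dots> = pop_sum c \<beta> (\<lambda>ps p. \<Sum>x<N. \<Sum>z<N. ?J ps p z x (?F x z)) ps p 0"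
    by (simp only: pop_sum_sum)
  also have "(\<lambda>ps p. \<Sum>x<N. \<Sum>z<N. ?J ps p z x (?F x z)) = ?R"
    by (intro ext) (rule Suc)
  finally show ?case by simp
qed

lemma loops_scan_eq_shape_moment:
  assumes "of_nat N * \<beta> = 1"
  shows "loops N (\<lambda>i j. (j, i)) (map Suc ps)
      (\<lambda>S. loops N Pair ks (\<lambda>w. scan (cyclic_weight c \<beta>) w S)) = shape_moment c (of_nat N) \<beta> ks ps"
proof (induction ks arbitrary: ps)
  case Nil
  show ?case
  proof (cases ps)
    \<comment> \<open>Each group left on the stack holds at least one letter, owing to
      \<open>Suc\<close>, and \<open>scan\<close> vanishes on a nonempty stack once the word is used
      up.\<close>
    case (Cons q qs)
    then show ?thesis by (simp add: loops_Cons chain_loops_Suc chain_loops_zero del: loops.simps(2))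
  qed simp
next
  case (Cons k ks)
  have "loops N (\<lambda>i j. (j, i)) (map Suc ps)
      (\<lambda>S. loops N Pair (k # ks) (\<lambda>w. scan (cyclic_weight c \<beta>) w S)) =
      (\<Sum>x<N. \<Sum>y<N. chain_loops N (\<lambda>i j. (j, i)) (map Suc ps) 0 y x
        (\<lambda>S. chain_loops N Pair ks k y x (\<lambda>w. scan (cyclic_weight c \<beta>) w S)))"
    by (simp add: chain_loops_0 loops_Cons loops_sum del: loops.simps)
  then show ?case by (simp add: sum_chain_loops_scan_eq[OF assms Cons])
qed

subsection \<open>Traces of powers\<close>

lemma scan_map: "scan (\<lambda>l. \<kappa> (map f l)) w S = scan \<kappa> (map f w) (map f S)"
  by (induction w arbitrary: S) (simp_all add: cut_sum_eq_sum take_map drop_map rev_map)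

lemma scan_cong:
  assumes "\<And>l. l \<noteq> [] \<Longrightarrow> set l \<subseteq> B \<Longrightarrow> \<kappa> l = \<kappa>' l" and "set w \<subseteq> B" and "set S \<subseteq> B"
  shows "scan \<kappa> w S = scan \<kappa>' w S"
  using assms(2,3)
proof (induction w arbitrary: S)
  case (Cons b w)
  have "scan \<kappa> w (drop j S) = scan \<kappa>' w (drop j S)" for j
    using Cons.prems by (intro Cons.IH) (auto dest: in_set_dropD)
  moreover have "\<kappa> (rev (take j S) @ [b]) = \<kappa>' (rev (take j S) @ [b])" for j
    using Cons.prems by (intro assms(1)) (auto dest: in_set_takeD)
  ultimately show ?case using Cons.IH[of "b # S"] Cons.prems by (simp add: cut_sum_eq_sum)
qed simp

text \<open>\<open>pow_mat\<close> multiplies on the right, while \<open>chain\<close> splits off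
  the first letter.\<close>

lemma pow_mat_Suc_left:
  assumes "A \<in> carrier_mat n n"
  shows "A ^\<^sub>m Suc k = A * A ^\<^sub>m k"
proof (induction k)
  case (Suc k)
  have "A ^\<^sub>m Suc (Suc k) = (A * A ^\<^sub>m k) * A" using Suc by simp
  also have "\<dots> = A * (A ^\<^sub>m k * A)"
    using assms by (intro assoc_mult_mat) auto
  finally show ?case by simp
qed (use assms in auto)

text \<open>A general additive \<open>L\<close> instead of the state lets the induction absorb the
  entry split off on the left.\<close>

lemma chain_eq_pow_mat_entry:
  assumes "A \<in> carrier_mat N N" and "additive L" and "y < N" and "x < N"
  shows "chain N Pair k y x (\<lambda>w. L (prod_list (map (($$) A) w))) = L ((A ^\<^sub>m k) $$ (y, x))"
  using assms(2,3)
proof (induction k arbitrary: y L)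
  case 0
  then show ?case using assms(1,4) additive.zero by auto
next
  case (Suc k)
  have "chain N Pair k z x (\<lambda>w. L (A $$ (y, z) * prod_list (map (($$) A) w))) =
      L (A $$ (y, z) * (A ^\<^sub>m k) $$ (z, x))" if "z < N" for z
    using Suc.prems(1) that by (intro Suc.IH) (auto simp: additive_def distrib_left)
  then have "chain N Pair (Suc k) y x (\<lambda>w. L (prod_list (map (($$) A) w))) =
      L (\<Sum>z<N. A $$ (y, z) * (A ^\<^sub>m k) $$ (z, x))"
    by (simp add: additive.sum[OF Suc.prems(1)])
  also have "(\<Sum>z<N. A $$ (y, z) * (A ^\<^sub>m k) $$ (z, x)) = (A ^\<^sub>m Suc k) $$ (y, x)"
    using assms(1,4) Suc.prems(2) unfolding pow_mat_Suc_left[OF assms(1)]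
    by (simp add: scalar_prod_def lessThan_atLeast0 del: pow_mat.simps)
  finally show ?case .
qed

lemma loops_eq_trace_powers:
  assumes "A \<in> carrier_mat N N" and "additive L"
  shows "loops N Pair ks (\<lambda>w. L (prod_list (map (($$) A) w))) =
    L (prod_list (map (\<lambda>k. Tr (A ^\<^sub>m k)) ks))"
  using assms(2)
proof (induction ks arbitrary: L)
  case (Cons k ks)
  let ?P = "prod_list (map (\<lambda>k. Tr (A ^\<^sub>m k)) ks)"
  have "loops N Pair ks (\<lambda>v. L (prod_list (map (($$) A) (u @ v)))) = L (prod_list (map (($$) A) u) * ?P)"
    for u
    using Cons.IH[of "\<lambda>b. L (prod_list (map (($$) A) u) * b)"] Cons.prems
    by (simp add: additive_def distrib_left)
  moreover have "chain N Pair k x x (\<lambda>u. L (prod_list (map (($$) A) u) * ?P)) =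
      L ((A ^\<^sub>m k) $$ (x, x) * ?P)" if "x < N" for x
    using that Cons.prems assms(1)
    by (intro chain_eq_pow_mat_entry[of A N "\<lambda>b. L (b * ?P)"]) (auto simp: additive_def distrib_right)
  ultimately have "loops N Pair (k # ks) (\<lambda>w. L (prod_list (map (($$) A) w))) =
      L (\<Sum>x<N. (A ^\<^sub>m k) $$ (x, x) * ?P)"
    by (simp add: additive.sum[OF Cons.prems])
  also have "dim_row (A ^\<^sub>m k) = N" using assms(1) by auto
  then have "(\<Sum>x<N. (A ^\<^sub>m k) $$ (x, x) * ?P) = Tr (A ^\<^sub>m k) * ?P"
    by (simp add: Tr_def sum_distrib_right)
  finally show ?case by simp
qed simp

text \<open>The mixed moments of the traces are scans over the exponents in two ways: for the free
  cumulants of the traces, and, after expansion into entries, for the group cumulants. Uniqueness of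
  cumulants does the rest.\<close>

lemma (in nc_probability_space) free_cumulant_trace_powers:
  assumes N: "N \<ge> 1" and A: "A \<in> carrier_mat N N"
    and cumulants: "\<And>l. l \<noteq> [] \<Longrightarrow> set l \<subseteq> {(i, j). i < N \<and> j < N} \<Longrightarrow>
      free_cumulant \<phi> (map (($$) A) l) = cyclic_weight c (1 / of_nat N) l"
    and "ks \<noteq> []"
  shows "free_cumulant \<phi> (map (\<lambda>k. Tr (A ^\<^sub>m k)) ks) = of_nat N * group_cumulant c (1 / of_nat N) ks"
  using \<open>ks \<noteq> []\<close>
proof (rule scan_unique[rotated])
  let ?T = "\<lambda>k. Tr (A ^\<^sub>m k)" and ?\<beta> = "1 / of_nat N :: complex"
  have inv: "of_nat N * ?\<beta> = 1" using N by simp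
  fix ks
  have "scan (\<lambda>ks. free_cumulant \<phi> (map ?T ks)) ks [] = \<phi> (prod_list (map ?T ks))"
    by (simp add: scan_map[where \<kappa> = "free_cumulant \<phi>"] state_prod_list_eq_scan state_one)
  also have "\<dots> = loops N Pair ks (\<lambda>w. \<phi> (prod_list (map (($$) A) w)))"
    using A state.add by (simp add: loops_eq_trace_powers additive_def)
  also have "\<dots> = loops N Pair ks (\<lambda>w. scan (\<lambda>l. free_cumulant \<phi> (map (($$) A) l)) w [])"
    by (simp add: scan_map[where \<kappa> = "free_cumulant \<phi>"] state_prod_list_eq_scan state_one)
  also have "\<dots> = loops N Pair ks (\<lambda>w. scan (cyclic_weight c ?\<beta>) w [])"
    by (intro loops_cong scan_cong[OF cumulants]) auto
  also have "\<dots> = shape_moment c (of_nat N) ?\<beta> ks []"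
    using loops_scan_eq_shape_moment[OF inv, of "[]"] by simp
  also have "\<dots> = scan (\<lambda>ks. of_nat N * group_cumulant c ?\<beta> ks) ks []"
    by (simp add: shape_moment_eq_scan)
  finally show "scan (\<lambda>ks. free_cumulant \<phi> (map ?T ks)) ks [] = \<dots>" .
qed

section \<open>Cyclicity modulo the length, and the one-by-one matrix\<close>

lemma path_Cons_iff:
  "path y (p # l) z \<longleftrightarrow>
    y = fst p \<and> snd (last (p # l)) = z \<and> (\<forall>s<length l. snd ((p # l) ! s) = fst (l ! s))"
proof (induction l arbitrary: y p)
  case Nil
  show ?case by (cases p) auto
next
  case (Cons q l)
  show ?case using Cons[of "snd p" q] by (cases p) (auto simp: All_less_Suc2)
qed

text \<open>\<open>path\<close> suits letterwise popping, whereas the hypotheses on the entries use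
  indices modulo the length; the last position is the one that wraps around.\<close>

lemma ex_cyclic_path_iff:
  assumes "l \<noteq> []"
  shows "(\<exists>y. path y l y) \<longleftrightarrow> (\<forall>s<length l. snd (l ! s) = fst (l ! ((s + 1) mod length l)))"
proof -
  obtain p l' where l: "l = p # l'" using assms by (cases l) auto
  have "(\<forall>s<length l. snd (l ! s) = fst (l ! ((s + 1) mod length l))) \<longleftrightarrow>
      (\<forall>s<length l'. snd (l ! s) = fst (l' ! s)) \<and> snd (l ! length l') = fst p"
    by (auto simp: l All_less_Suc)
  also have "\<dots> \<longleftrightarrow> (\<exists>y. path y l y)"
    by (auto simp: l path_Cons_iff last_conv_nth)
  finally show ?thesis by simp
qed

text \<open>Turns the powers of \<open>a\<close> into an instance of traces of matrix
  powers.\<close>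

lemma trace_powers_one_by_one: "Tr (mat 1 1 (\<lambda>_. a) ^\<^sub>m k) = (a::'a::semiring_1) ^ k"
proof -
  have "mat 1 1 (\<lambda>_. a) ^\<^sub>m k = mat 1 1 (\<lambda>_. a ^ k)"
    by (induction k) (auto intro!: eq_matI simp: scalar_prod_def power_commutes)
  then show ?thesis by (simp add: Tr_def)
qed

theorem mainTheorem2:
  fixes scA :: "complex \<Rightarrow> 'a::ring_1 \<Rightarrow> 'a" and \<phi> :: "'a \<Rightarrow> complex"
    and star :: "'a \<Rightarrow> 'a" and a :: 'a
    and scB :: "complex \<Rightarrow> 'b::ring_1 \<Rightarrow> 'b" and \<psi> :: "'b \<Rightarrow> complex"
    and N :: nat and A :: "'b mat"
  assumes "nc_probability_space_with_star scA \<phi> star"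
    and "nc_probability_space_with_star.selfadjoint star a"
    and "nc_probability_space scB \<psi>"
    and "N \<ge> 1" and "A \<in> carrier_mat N N"
    and "\<And>(r::nat) (i :: nat \<Rightarrow> nat). r \<ge> 1 \<Longrightarrow> (\<forall>s<r. i s < N) \<Longrightarrow>
      free_cumulant \<psi> (map (\<lambda>s. A $$ (i s, i ((s + 1) mod r))) [0..<r]) =
        1 / of_nat N ^ (r - 1) * free_cumulant \<phi> (replicate r a)"
    and "\<And>(r::nat) (i :: nat \<Rightarrow> nat) (j :: nat \<Rightarrow> nat).
      r \<ge> 1 \<Longrightarrow> (\<forall>s<r. i s < N \<and> j s < N) \<Longrightarrow> \<not> (\<forall>s<r. j s = i ((s + 1) mod r)) \<Longrightarrow>
      free_cumulant \<psi> (map (\<lambda>s. A $$ (i s, j s)) [0..<r]) = 0"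
  shows "\<forall>(n::nat) (k :: nat \<Rightarrow> nat). n \<ge> 1 \<longrightarrow> (\<forall>s<n. k s \<ge> 1) \<longrightarrow>
      free_cumulant \<psi> (map (\<lambda>s. Tr (A ^\<^sub>m k s)) [0..<n]) =
        of_nat N powi (2 - int n) * free_cumulant \<phi> (map (\<lambda>s. a ^ k s) [0..<n])"
proof (intro allI impI)
  interpret A: nc_probability_space scA \<phi>
    using assms(1) by (simp add: nc_probability_space_with_star_def)
  interpret B: nc_probability_space scB \<psi> by (fact assms(3))
  let ?c = "\<lambda>r. free_cumulant \<phi> (replicate r a)"
  fix n :: nat and k :: "nat \<Rightarrow> nat"
  assume n: "n \<ge> 1"
  define ks where "ks = map k [0..<n]"
  \<comment> \<open>The two hypotheses on the entries together state exactly this: one covers the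
    cyclic words, the other all remaining ones.\<close>
  have "free_cumulant \<psi> (map (($$) A) l) = cyclic_weight ?c (1 / of_nat N) l"
    if "l \<noteq> []" "set l \<subseteq> {(i, j). i < N \<and> j < N}" for l
  proof -
    let ?r = "length l" and ?i = "\<lambda>s. fst (l ! s)" and ?j = "\<lambda>s. snd (l ! s)"
    have r: "?r \<ge> 1" using that(1) by (simp add: Suc_le_eq)
    have bound: "\<forall>s<?r. ?i s < N \<and> ?j s < N" using that(2) nth_mem by fastforce
    have word: "map (($$) A) l = map (\<lambda>s. A $$ (?i s, ?j s)) [0..<?r]"
      by (rule nth_equalityI) auto
    show ?thesis
    proof (cases "\<forall>s<?r. ?j s = ?i ((s + 1) mod ?r)")
      case True
      then have "map (($$) A) l = map (\<lambda>s. A $$ (?i s, ?i ((s + 1) mod ?r))) [0..<?r]"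
        unfolding word by (intro map_cong) auto
      then show ?thesis
        using True ex_cyclic_path_iff[OF that(1)] assms(6)[OF r, of ?i] bound
        by (simp add: cyclic_weight_def power_one_over)
    next
      case False
      then show ?thesis
        using ex_cyclic_path_iff[OF that(1)] assms(7)[OF r bound False] False
        by (auto simp: cyclic_weight_def word)
    qed
  qed
  then have B: "free_cumulant \<psi> (map (\<lambda>k. Tr (A ^\<^sub>m k)) ks) =
      of_nat N * group_cumulant ?c (1 / of_nat N) ks"
    using n by (intro B.free_cumulant_trace_powers assms(4,5)) (auto simp: ks_def)
  \<comment> \<open>For \<open>N = 1\<close> every word is cyclic and all powers of
    \<open>1/N\<close> are 1, so the cumulants of \<open>a\<close> themselves fit the
    pattern.\<close>
  have "free_cumulant \<phi> (map (($$) (mat 1 1 (\<lambda>_. a))) l) = cyclic_weight ?c (1 / of_nat 1) l"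
    if "set l \<subseteq> {(i, j). i < 1 \<and> j < 1}" for l :: "(nat \<times> nat) list"
  proof -
    have l: "l = replicate (length l) (0, 0)"
      using that by (auto simp: list_eq_iff_nth_eq dest: nth_mem)
    have "path 0 (replicate m (0, 0)) 0" for m by (induction m) auto
    then have "\<exists>y. path y l y" using l by metis
    moreover have "map (($$) (mat 1 1 (\<lambda>_. a))) l = replicate (length l) a"
      by (subst l) simp
    ultimately show ?thesis by (simp add: cyclic_weight_def)
  qed
  then have "free_cumulant \<phi> (map (\<lambda>k. Tr (mat 1 1 (\<lambda>_. a) ^\<^sub>m k)) ks) =
      of_nat 1 * group_cumulant ?c (1 / of_nat 1) ks"
    using n by (intro A.free_cumulant_trace_powers) (auto simp: ks_def)
  then have A: "free_cumulant \<phi> (map ((^) a) ks) = group_cumulant ?c 1 ks"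
    by (simp only: trace_powers_one_by_one) simp
  have "group_cumulant ?c (1 / of_nat N) ks = (1 / of_nat N) ^ (n - 1) * group_cumulant ?c 1 ks"
    using group_cumulant_rescale[of "1 / of_nat N" "of_nat N" ?c ks] assms(4) by (simp add: ks_def)
  \<comment> \<open>One factor \<open>N\<close> for the emptied component against
    \<open>n - 1\<close> mergers.\<close>
  moreover have "of_nat N * (1 / of_nat N) ^ (n - 1) = (of_nat N :: complex) powi (2 - int n)"
  proof -
    obtain m where m: "n = Suc m" using n by (cases n) auto
    have "2 - int n = 1 - int m" by (simp add: m)
    then show ?thesis using assms(4) by (simp only:) (simp add: m power_int_diff power_one_over)
  qed
  ultimately have "free_cumulant \<psi> (map (\<lambda>k. Tr (A ^\<^sub>m k)) ks) =
      of_nat N powi (2 - int n) * free_cumulant \<phi> (map ((^) a) ks)"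
    unfolding A B by (simp flip: mult.assoc)
  then show "free_cumulant \<psi> (map (\<lambda>s. Tr (A ^\<^sub>m k s)) [0..<n]) =
      of_nat N powi (2 - int n) * free_cumulant \<phi> (map (\<lambda>s. a ^ k s) [0..<n])"
    by (simp add: ks_def o_def)
qed

end
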